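(* Fix an integer $K\ge2$, a constant $C>1$ and a constant $\kappa\in(0,1)$ (for instance $\kappa=\tfrac12$). There is a constant $c>0$ (depending only on $K,C,\kappa$) such that the following holds. Consider a sequence of stochastic block models with $K$ communities of sizes $n_1,\dots,n_K$ and two Bernoulli parameters $\theta>\rho>0$ (all depending on the index of the sequence), and write $n_{\min}=\min_\alpha n_\alpha$, $n_{\max}=\max_\alpha n_\alpha$. Assume that $n_{\min}\to\infty$, and that along the sequence $\theta/\rho\le C$, $\theta<\kappa$ and $$c\,(\theta-\rho)>\Big(\frac{n_{\max}}{n_{\min}}\Big)^{\frac23}\max\Big\{n_{\min}^{-\frac13}\theta^{\frac12}(\log n_{\min})^{\frac16},\ n_{\min}^{-\frac16}\theta^{\frac56}(\log n_{\min})^{\frac16}\Big\}.$$ Then $\mathrm{AWCD}_1$ achieves consistent exact recovery: there are thresholds $\lambda$ (depending on the index of the sequence) such that its output $W$ satisfies $\mathbb P(\forall\, i,j:\ W_{ij}=W^*_{ij})\to1$.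
   Context: Model. The stochastic block model here is the random simple undirected graph on a vertex set partitioned into $K$ communities $\mathcal C_1^*,\dots,\mathcal C_K^*$ of deterministic sizes $n_1,\dots,n_K$, whose edges are independent Bernoulli variables with mean $\theta$ for pairs of distinct vertices in the same community and mean $\rho$ for pairs in different communities. $\mathcal Y$ is its symmetric $0/1$ adjacency matrix (zero diagonal). $W^*_{ij}=1$ if $i,j$ belong to the same community and $W^*_{ij}=0$ otherwise. Algorithm $\mathrm{AWCD}_1$ (one step, input $\mathcal Y$ and a threshold $\lambda\in\mathbb R$). Let $\mathcal C_i=\{j:\mathcal Y_{ij}=1\}$. For all vertices $i,j$ define $$S_{ij}=(\mathcal Y\mathcal Y\mathcal Y)_{ij}-\mathbb 1(\mathcal Y_{ij}=1)\,(|\mathcal C_i|+|\mathcal C_j|-1),\qquad N_{ij}=|\mathcal C_i|\,\big(|\mathcal C_j|-\mathbb 1(i=j)\big),$$ $$\widetilde\theta_{ij}=\frac{S_{ij}}{N_{ij}},\qquad \widetilde\theta_{i\lor j}=\frac{S_{ii}+2S_{ij}+S_{jj}}{N_{ii}+2N_{ij}+N_{jj}},$$ $$T_{ij}=N_{ii}\,\mathcal K(\widetilde\theta_{ii},\widetilde\theta_{i\lor j})+N_{jj}\,\mathcal K(\widetilde\theta_{jj},\widetilde\theta_{i\lor j})+N_{ij}\,\mathcal K(\widetilde\theta_{ij},\widetilde\theta_{i\lor j}),$$ where $\mathcal K(p,q)=p\log\frac pq+(1-p)\log\frac{1-p}{1-q}$ is the Kullback–Leibler divergence between Bernoulli distributions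 with means $p$ and $q$ ($0\log0=0$). Output: $W_{ij}=\mathbb 1(T_{ij}\le\lambda)$. Convention: if $T_{ij}$ is undefined (a denominator vanishes or an estimator lies outside $[0,1]$), put $T_{ij}=0$. The threshold may depend on the model parameters and community sizes. *)

theory Defs
  imports "HOL-Probability.Probability"
begin

text \<open>
  The vertex set is \<open>{..<n}\<close>; the partition into \<open>K\<close> communities is given by a labelling
  \<open>z\<close> that maps \<open>{..<n}\<close> onto \<open>{..<K}\<close>.
\<close>

definition community :: "nat \<Rightarrow> (nat \<Rightarrow> nat) \<Rightarrow> nat \<Rightarrow> nat set" where
  "community n z a = {i \<in> {..<n}. z i = a}"

definition n_min :: "nat \<Rightarrow> nat \<Rightarrow> (nat \<Rightarrow> nat) \<Rightarrow> nat" where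
  "n_min K n z = Min ((\<lambda>a. card (community n z a)) ` {..<K})"

definition n_max :: "nat \<Rightarrow> nat \<Rightarrow> (nat \<Rightarrow> nat) \<Rightarrow> nat" where
  "n_max K n z = Max ((\<lambda>a. card (community n z a)) ` {..<K})"

definition same_community :: "(nat \<Rightarrow> nat) \<Rightarrow> nat \<Rightarrow> nat \<Rightarrow> nat" where
  "same_community z i j = (if z i = z j then 1 else 0)"

text \<open>
  An unordered pair of distinct vertices is encoded as the ordered pair \<open>(i, j)\<close> with
  \<open>i < j\<close>. A sample of the model is the indicator function of the edge set.
\<close>

definition sbm :: "nat \<Rightarrow> (nat \<Rightarrow> nat) \<Rightarrow> real \<Rightarrow> real \<Rightarrow> (nat \<times> nat \<Rightarrow> bool) pmf" where
  "sbm n z \<theta> \<rho> =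
     Pi_pmf {(i, j). i < j \<and> j < n} False
       (\<lambda>(i, j). bernoulli_pmf (if z i = z j then \<theta> else \<rho>))"

definition adjacency :: "(nat \<times> nat \<Rightarrow> bool) \<Rightarrow> nat \<Rightarrow> nat \<Rightarrow> real" where
  "adjacency g i j = (if i \<noteq> j \<and> g (min i j, max i j) then 1 else 0)"

text \<open>
  The quantities of the algorithm, for an adjacency matrix \<open>Y\<close> with index set \<open>{..<n}\<close>.
\<close>

definition nbhd :: "nat \<Rightarrow> (nat \<Rightarrow> nat \<Rightarrow> real) \<Rightarrow> nat \<Rightarrow> nat set" where
  "nbhd n Y i = {j \<in> {..<n}. Y i j = 1}"

text \<open>The double sum is the entry \<open>(i, j)\<close> of the matrix product \<open>Y Y Y\<close>.\<close>

definition S_count :: "nat \<Rightarrow> (nat \<Rightarrow> nat \<Rightarrow> real) \<Rightarrow> nat \<Rightarrow> nat \<Rightarrow> real" where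
  "S_count n Y i j =
     (\<Sum>k<n. \<Sum>l<n. Y i k * Y k l * Y l j)
     - (if Y i j = 1 then real (card (nbhd n Y i)) + real (card (nbhd n Y j)) - 1 else 0)"

definition N_count :: "nat \<Rightarrow> (nat \<Rightarrow> nat \<Rightarrow> real) \<Rightarrow> nat \<Rightarrow> nat \<Rightarrow> real" where
  "N_count n Y i j =
     real (card (nbhd n Y i)) * (real (card (nbhd n Y j)) - (if i = j then 1 else 0))"

definition theta_est :: "nat \<Rightarrow> (nat \<Rightarrow> nat \<Rightarrow> real) \<Rightarrow> nat \<Rightarrow> nat \<Rightarrow> real" where
  "theta_est n Y i j = S_count n Y i j / N_count n Y i j"

definition S_join :: "nat \<Rightarrow> (nat \<Rightarrow> nat \<Rightarrow> real) \<Rightarrow> nat \<Rightarrow> nat \<Rightarrow> real" where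
  "S_join n Y i j = S_count n Y i i + 2 * S_count n Y i j + S_count n Y j j"

definition N_join :: "nat \<Rightarrow> (nat \<Rightarrow> nat \<Rightarrow> real) \<Rightarrow> nat \<Rightarrow> nat \<Rightarrow> real" where
  "N_join n Y i j = N_count n Y i i + 2 * N_count n Y i j + N_count n Y j j"

definition theta_join :: "nat \<Rightarrow> (nat \<Rightarrow> nat \<Rightarrow> real) \<Rightarrow> nat \<Rightarrow> nat \<Rightarrow> real" where
  "theta_join n Y i j = S_join n Y i j / N_join n Y i j"

text \<open>
  Kullback-Leibler divergence of Bernoulli laws. The convention \<open>0 log 0 = 0\<close> is automatic.
  The formula gives a junk value (instead of infinity) for \<open>q \<in> {0, 1}\<close>, \<open>p \<noteq> q\<close>; this does
  not arise in \<open>T_stat\<close>, where the second argument is an average, with positive weights, of the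
  three possible first arguments, which all lie in \<open>[0, 1]\<close>.
\<close>

definition KL_bernoulli :: "real \<Rightarrow> real \<Rightarrow> real" where
  "KL_bernoulli p q = p * ln (p / q) + (1 - p) * ln ((1 - p) / (1 - q))"

definition T_defined :: "nat \<Rightarrow> (nat \<Rightarrow> nat \<Rightarrow> real) \<Rightarrow> nat \<Rightarrow> nat \<Rightarrow> bool" where
  "T_defined n Y i j \<longleftrightarrow>
     N_count n Y i i \<noteq> 0 \<and> N_count n Y j j \<noteq> 0 \<and> N_count n Y i j \<noteq> 0 \<and> N_join n Y i j \<noteq> 0 \<and>
     {theta_est n Y i i, theta_est n Y j j, theta_est n Y i j, theta_join n Y i j} \<subseteq> {0..1}"

definition T_stat :: "nat \<Rightarrow> (nat \<Rightarrow> nat \<Rightarrow> real) \<Rightarrow> nat \<Rightarrow> nat \<Rightarrow> real" where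
  "T_stat n Y i j =
     (if T_defined n Y i j then
        N_count n Y i i * KL_bernoulli (theta_est n Y i i) (theta_join n Y i j)
        + N_count n Y j j * KL_bernoulli (theta_est n Y j j) (theta_join n Y i j)
        + N_count n Y i j * KL_bernoulli (theta_est n Y i j) (theta_join n Y i j)
      else 0)"

definition AWCD1 :: "nat \<Rightarrow> (nat \<Rightarrow> nat \<Rightarrow> real) \<Rightarrow> real \<Rightarrow> nat \<Rightarrow> nat \<Rightarrow> nat" where
  "AWCD1 n Y t i j = (if T_stat n Y i j \<le> t then 1 else 0)"

end

theory Submission
  imports Defs "HOL-Real_Asymp.Real_Asymp"
begin

text \<open>
  Given the neighbourhoods of \<open>i\<close> and \<open>j\<close>, the count \<open>S\<^sub>i\<^sub>j\<close> is a sum of independent weighted Bernoulli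
  variables, so \<open>theta_est\<close> is close to \<open>\<rho> + (\<theta> - \<rho>) * \<langle>x\<^sub>i, x\<^sub>j\<rangle>\<close>, where the vector \<open>x\<^sub>i\<close> lists the
  shares of the communities among the neighbours of \<open>i\<close>. For vertices of the same community the
  vectors \<open>x\<^sub>i\<close> and \<open>x\<^sub>j\<close> differ only by degree fluctuations, so the three estimators nearly agree. For
  different communities \<open>\<theta>\<^sub>i\<^sub>i + \<theta>\<^sub>j\<^sub>j - 2 \<theta>\<^sub>i\<^sub>j\<close> is about \<open>(\<theta> - \<rho>) * |x\<^sub>i - x\<^sub>j|\<^sup>2\<close>, which is of order
  at least \<open>(\<theta> - \<rho>)\<^sup>3 n_min\<^sup>2 / (\<theta>\<^sup>2 n_max\<^sup>2)\<close>. The assumption makes this a large multiple of all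
  fluctuations, and the divergences in \<open>T_stat\<close> are quadratic in these differences.
\<close>

subsection \<open>A Chernoff bound for weighted sums of Bernoulli variables\<close>

text \<open>The obstacle is that the edges counted by \<open>S_count\<close> run between two random
  sets. After the correction term they avoid \<open>i\<close> and \<open>j\<close>, while the two
  neighbourhoods are determined by the edges at \<open>i\<close> or \<open>j\<close>. An edge inside
  both sets is met from either end, hence weights up to 2. The exponents of the assumption come from
  the case of equal sizes m, with L = log m. Given the neighbourhoods, about
  \<open>\<theta>^2 m^2\<close> pairs are tested, so the estimators fluctuate by sqrt(L /
  (\<open>\<theta> m^2\<close>)). Degree fluctuations sqrt(\<open>\<theta> m L\<close>) relative to
  degrees \<open>\<theta> m\<close>, times \<open>\<theta> - \<rho> \<le> \<theta>\<close>, give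
  sqrt(\<open>\<theta> L / m\<close>). Asking that \<open>(\<theta> - \<rho>)^3 / \<theta>^2\<close>
  exceed both and taking cube roots yields the two entries of the maximum; the size ratio enters the
  signal squared and so gets the power 2/3. All constants are paid by the factor
  \<open>c^3\<close>.\<close>

lemma exp_le_quadratic:
  fixes s :: real
  assumes "\<bar>s\<bar> \<le> 1"
  shows "exp s \<le> 1 + s + s\<^sup>2"
proof (cases "s \<ge> 0")
  case True
  then show ?thesis using assms by (intro exp_bound) auto
next
  case False
  define u where "u = - s"
  have u: "u > 0" using False by (simp add: u_def)
  have "exp s = 1 / exp u" by (simp add: u_def exp_minus field_simps)
  also have "\<dots> \<le> 1 / (1 + u)"
    using u exp_ge_add_one_self[of u] by (intro divide_left_mono) auto
  also have "\<dots> \<le> 1 - u + u\<^sup>2"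
  proof -
    have "(1 - u + u\<^sup>2) * (1 + u) = 1 + u ^ 3" by (simp add: algebra_simps power2_eq_square power3_eq_cube)
    then show ?thesis using u by (simp add: divide_le_eq)
  qed
  finally show ?thesis by (simp add: u_def)
qed

lemma expectation_exp_weighted_sum_le:
  fixes w p :: "'a \<Rightarrow> real"
  assumes fin: "finite A" and p: "\<And>e. e \<in> A \<Longrightarrow> 0 \<le> p e \<and> p e \<le> 1"
    and w: "\<And>e. e \<in> A \<Longrightarrow> 0 \<le> w e \<and> w e \<le> 2"
    and t: "\<bar>t\<bar> \<le> 1/2"
  defines "M \<equiv> Pi_pmf A False (\<lambda>e. bernoulli_pmf (p e))"
  shows "integrable (measure_pmf M) (\<lambda>g. exp (t * (\<Sum>e\<in>A. w e * of_bool (g e))))"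
    and "measure_pmf.expectation M (\<lambda>g. exp (t * (\<Sum>e\<in>A. w e * of_bool (g e))))
      \<le> exp ((t + 2 * t\<^sup>2) * (\<Sum>e\<in>A. w e * p e))"
proof -
  let ?f = "\<lambda>e b. exp (t * (w e * of_bool b))"
  have eq: "(\<lambda>g. exp (t * (\<Sum>e\<in>A. w e * of_bool (g e)))) = (\<lambda>g. \<Prod>e\<in>A. ?f e (g e))"
    by (rule ext) (simp only: exp_sum[OF fin] sum_distrib_left)
  have int: "integrable (measure_pmf (bernoulli_pmf (p e))) (?f e)" for e
    by (rule integrable_measure_pmf_finite) (rule finite_subset[OF subset_UNIV], simp)
  show "integrable (measure_pmf M) (\<lambda>g. exp (t * (\<Sum>e\<in>A. w e * of_bool (g e))))"
    unfolding eq M_def using fin int by (intro integrable_prod_Pi_pmf) auto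
  have one: "measure_pmf.expectation (bernoulli_pmf (p e)) (?f e)
      \<le> exp ((t + 2 * t\<^sup>2) * (w e * p e))" if e: "e \<in> A" for e
  proof -
    define s where "s = t * w e"
    have "\<bar>t\<bar> * \<bar>w e\<bar> \<le> (1/2) * 2" using t w[OF e] by (intro mult_mono) auto
    then have s: "\<bar>s\<bar> \<le> 1" by (simp add: s_def abs_mult)
    have "measure_pmf.expectation (bernoulli_pmf (p e)) (?f e) = p e * exp s + (1 - p e)"
      using p[OF e] by (simp add: s_def)
    also have "\<dots> \<le> p e * (1 + s + s\<^sup>2) + (1 - p e)"
      using p[OF e] exp_le_quadratic[OF s] by (intro add_right_mono mult_left_mono) auto
    also have "\<dots> = 1 + p e * (s + s\<^sup>2)" by (simp add: algebra_simps)
    also have "\<dots> \<le> 1 + p e * (s + 2 * t\<^sup>2 * w e)"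
    proof -
      have "t\<^sup>2 * (w e * w e) \<le> t\<^sup>2 * (2 * w e)"
        using w[OF e] by (intro mult_left_mono mult_right_mono) auto
      then have "s\<^sup>2 \<le> 2 * t\<^sup>2 * w e" by (simp add: s_def power2_eq_square algebra_simps)
      then show ?thesis using p[OF e] by (intro add_left_mono mult_left_mono) auto
    qed
    also have "\<dots> \<le> exp (p e * (s + 2 * t\<^sup>2 * w e))" by (rule exp_ge_add_one_self)
    also have "p e * (s + 2 * t\<^sup>2 * w e) = (t + 2 * t\<^sup>2) * (w e * p e)"
      by (simp add: s_def algebra_simps)
    finally show ?thesis .
  qed
  have "measure_pmf.expectation M (\<lambda>g. exp (t * (\<Sum>e\<in>A. w e * of_bool (g e))))
      = (\<Prod>e\<in>A. measure_pmf.expectation (bernoulli_pmf (p e)) (?f e))"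
    unfolding eq M_def using fin int by (intro expectation_prod_Pi_pmf) auto
  also have "\<dots> \<le> (\<Prod>e\<in>A. exp ((t + 2 * t\<^sup>2) * (w e * p e)))"
    using one by (intro prod_mono conjI integral_nonneg) auto
  also have "\<dots> = exp ((t + 2 * t\<^sup>2) * (\<Sum>e\<in>A. w e * p e))"
    using fin by (simp add: exp_sum sum_distrib_left)
  finally show "measure_pmf.expectation M (\<lambda>g. exp (t * (\<Sum>e\<in>A. w e * of_bool (g e))))
      \<le> exp ((t + 2 * t\<^sup>2) * (\<Sum>e\<in>A. w e * p e))" .
qed

lemma prob_ge_le_exp:
  fixes X :: "'a \<Rightarrow> real"
  assumes "integrable (measure_pmf M) (\<lambda>g. exp (t * X g))"
    and "measure_pmf.expectation M (\<lambda>g. exp (t * X g)) \<le> b"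
    and "\<And>g. g \<in> B \<Longrightarrow> t * X g \<ge> x"
  shows "measure_pmf.prob M B \<le> b * exp (- x)"
proof -
  have "measure_pmf.prob M B \<le> measure_pmf.prob M {g \<in> space (measure_pmf M). exp (t * X g) \<ge> exp x}"
    using assms(3) by (intro measure_pmf.finite_measure_mono) auto
  also have "\<dots> \<le> measure_pmf.expectation M (\<lambda>g. exp (t * X g)) / exp x"
    by (intro integral_Markov_inequality_measure[where A="{}"] assms(1)) auto
  also have "\<dots> \<le> b / exp x" using assms(2) by (intro divide_right_mono) auto
  finally show ?thesis by (simp add: exp_minus field_simps)
qed

lemma weighted_chernoff:
  fixes w p :: "'a \<Rightarrow> real"
  assumes fin: "finite A" and p: "\<And>e. e \<in> A \<Longrightarrow> 0 \<le> p e \<and> p e \<le> 1"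
    and w: "\<And>e. e \<in> A \<Longrightarrow> 0 \<le> w e \<and> w e \<le> 2"
    and M: "(\<Sum>e\<in>A. w e * p e) \<le> M" "M > 0" and a: "0 \<le> a" "a \<le> 2 * M"
  shows "measure_pmf.prob (Pi_pmf A False (\<lambda>e. bernoulli_pmf (p e)))
      {g. \<bar>(\<Sum>e\<in>A. w e * of_bool (g e)) - (\<Sum>e\<in>A. w e * p e)\<bar> \<ge> a} \<le> 2 * exp (- (a\<^sup>2 / (8 * M)))"
proof -
  define P where "P = Pi_pmf A False (\<lambda>e. bernoulli_pmf (p e))"
  define \<mu> where "\<mu> = (\<Sum>e\<in>A. w e * p e)"
  define X where "X = (\<lambda>g. \<Sum>e\<in>A. w e * of_bool (g e) :: real)"
  \<comment> \<open>The minimiser of \<open>2 * t^2 * M - t * a\<close>; the premise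
    \<open>a \<le> 2 * M\<close> keeps it within 1/2.\<close>
  define t where "t = a / (4 * M)"
  have t: "0 \<le> t" "\<bar>t\<bar> \<le> 1/2" "\<bar>- t\<bar> \<le> 1/2" using M a by (auto simp: t_def field_simps)
  have sq: "2 * t\<^sup>2 * \<mu> - t * a \<le> - (a\<^sup>2 / (8 * M))"
  proof -
    have "2 * t\<^sup>2 * \<mu> \<le> 2 * t\<^sup>2 * M" using M by (intro mult_left_mono) (auto simp: \<mu>_def)
    also have "\<dots> = t * a / 2" using M by (simp add: t_def field_simps power2_eq_square)
    finally have "2 * t\<^sup>2 * \<mu> - t * a \<le> - (t * a / 2)" by simp
    also have "t * a / 2 = a\<^sup>2 / (8 * M)" by (simp add: t_def power2_eq_square)
    finally show ?thesis .
  qed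
  have "measure_pmf.prob P {g. X g \<ge> \<mu> + a} \<le> exp ((t + 2 * t\<^sup>2) * \<mu>) * exp (- (t * (\<mu> + a)))"
    unfolding P_def
    by (rule prob_ge_le_exp[where t=t and X=X])
      (use expectation_exp_weighted_sum_le[OF fin p w t(2)] t(1) in \<open>auto simp: X_def \<mu>_def intro: mult_left_mono\<close>)
  also have "\<dots> = exp (2 * t\<^sup>2 * \<mu> - t * a)" by (simp add: exp_add[symmetric] algebra_simps)
  also have "\<dots> \<le> exp (- (a\<^sup>2 / (8 * M)))" using sq by simp
  finally have up: "measure_pmf.prob P {g. X g \<ge> \<mu> + a} \<le> exp (- (a\<^sup>2 / (8 * M)))" .
  have "measure_pmf.prob P {g. X g \<le> \<mu> - a} \<le> exp ((- t + 2 * (- t)\<^sup>2) * \<mu>) * exp (- (- t * (\<mu> - a)))"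
    unfolding P_def
    by (rule prob_ge_le_exp[where t="-t" and X=X])
      (use expectation_exp_weighted_sum_le[OF fin p w t(3)] t(1) in \<open>auto simp: X_def \<mu>_def intro: mult_left_mono\<close>)
  also have "\<dots> = exp (2 * t\<^sup>2 * \<mu> - t * a)" by (simp add: exp_add[symmetric] algebra_simps)
  also have "\<dots> \<le> exp (- (a\<^sup>2 / (8 * M)))" using sq by simp
  finally have lo: "measure_pmf.prob P {g. X g \<le> \<mu> - a} \<le> exp (- (a\<^sup>2 / (8 * M)))" .
  have "measure_pmf.prob P {g. \<bar>X g - \<mu>\<bar> \<ge> a}
      \<le> measure_pmf.prob P ({g. X g \<ge> \<mu> + a} \<union> {g. X g \<le> \<mu> - a})"
    by (intro measure_pmf.finite_measure_mono) auto
  also have "\<dots> \<le> measure_pmf.prob P {g. X g \<ge> \<mu> + a} + measure_pmf.prob P {g. X g \<le> \<mu> - a}"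
    by (rule measure_Un_le) auto
  finally show ?thesis using up lo by (simp add: P_def X_def \<mu>_def)
qed

text \<open>Conditioning on the coordinates in \<open>A\<close>: a bound that holds for every frozen
  value \<open>f\<close> survives integration over \<open>f\<close>.\<close>

lemma prob_Pi_pmf_union_le:
  assumes "finite A" "finite B" "A \<inter> B = {}" "0 \<le> b"
    and bound: "\<And>f. measure_pmf.prob (Pi_pmf B d p) {g. Q (\<lambda>x. if x \<in> A then f x else g x)} \<le> b"
  shows "measure_pmf.prob (Pi_pmf (A \<union> B) d p) {h. Q h} \<le> b"
proof -
  have "emeasure (measure_pmf (Pi_pmf (A \<union> B) d p)) {h. Q h}
      = (\<integral>\<^sup>+ f. emeasure (measure_pmf (Pi_pmf B d p)) {g. Q (\<lambda>x. if x \<in> A then f x else g x)} \<partial>Pi_pmf A d p)"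
    unfolding Pi_pmf_union[OF assms(1-3)] pair_pmf_def
    by (simp add: map_bind_pmf emeasure_return_pmf vimage_def flip: map_pmf_def)
  also have "\<dots> \<le> (\<integral>\<^sup>+ f. ennreal b \<partial>Pi_pmf A d p)"
    using bound by (intro nn_integral_mono) (simp add: measure_pmf.emeasure_eq_measure ennreal_leI)
  also have "\<dots> = ennreal b" by simp
  finally show ?thesis using assms(4) by (simp add: measure_pmf.emeasure_eq_measure)
qed

subsection \<open>Concentration of edge counts\<close>

definition edge_mean :: "(nat \<Rightarrow> nat) \<Rightarrow> real \<Rightarrow> real \<Rightarrow> nat \<Rightarrow> nat \<Rightarrow> real" where
  "edge_mean z \<theta> \<rho> k l = (if k = l then 0 else if z k = z l then \<theta> else \<rho>)"

text \<open>The number of ordered pairs in \<open>A \<times> B\<close> that realise the unordered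
  edge \<open>e\<close>; it is 2 exactly when both ends lie in \<open>A \<inter> B\<close>.\<close>

definition pair_weight :: "nat set \<Rightarrow> nat set \<Rightarrow> nat \<times> nat \<Rightarrow> real" where
  "pair_weight A B e = of_bool (fst e \<in> A \<and> snd e \<in> B) + of_bool (snd e \<in> A \<and> fst e \<in> B)"

lemma pair_weight_bounds: "0 \<le> pair_weight A B e" "pair_weight A B e \<le> 2"
  by (auto simp: pair_weight_def)

lemma finite_edges: "finite {(i, j). i < j \<and> j < (n::nat)}"
  by (rule finite_subset[of _ "{..<n} \<times> {..<n}"]) auto

text \<open>Passes from ordered pairs, where each edge variable may occur twice, to the independent
  coordinates of the model. As \<open>A\<close> and \<open>B\<close> avoid \<open>I\<close>, only
  edges without an end in \<open>I\<close> occur.\<close>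

lemma sum_pair_weight:
  fixes h :: "nat \<times> nat \<Rightarrow> real"
  assumes "A \<subseteq> {..<n} - I" "B \<subseteq> {..<n} - I"
  shows "(\<Sum>k\<in>A. \<Sum>l\<in>B. if k = l then 0 else h (min k l, max k l))
    = (\<Sum>e\<in>{(i, j). i < j \<and> j < n \<and> i \<notin> I \<and> j \<notin> I}. pair_weight A B e * h e)"
proof -
  define f where "f = (\<lambda>(k, l). if k = l then 0 else h (min k l, max k l))"
  define E where "E = {(i, j). i < j \<and> j < n \<and> i \<notin> I \<and> j \<notin> I}"
  have finE: "finite E" unfolding E_def by (rule finite_subset[OF _ finite_edges[of n]]) auto
  have fin: "finite A" "finite B" using assms by (auto intro: finite_subset)
  have "(\<Sum>k\<in>A. \<Sum>l\<in>B. if k = l then 0 else h (min k l, max k l)) = sum f (A \<times> B)"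
    by (simp add: f_def sum.cartesian_product)
  also have "\<dots> = sum f {e \<in> A \<times> B. fst e < snd e} + sum f {e \<in> A \<times> B. \<not> fst e < snd e}"
    using fin by (subst sum.union_disjoint[symmetric]) (auto intro!: sum.cong)
  also have "sum f {e \<in> A \<times> B. \<not> fst e < snd e} = sum f {e \<in> A \<times> B. snd e < fst e}"
    using fin by (intro sum.mono_neutral_right) (auto simp: f_def split: if_splits)
  also have "\<dots> = sum (h \<circ> prod.swap) {e \<in> A \<times> B. snd e < fst e}"
    by (intro sum.cong) (auto simp: f_def min_def max_def)
  also have "\<dots> = sum h (prod.swap ` {e \<in> A \<times> B. snd e < fst e})"
    by (subst sum.reindex) (auto intro: inj_onI)
  also have "prod.swap ` {e \<in> A \<times> B. snd e < fst e} = {e \<in> E. snd e \<in> A \<and> fst e \<in> B}"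
    using assms by (force simp: E_def image_iff)
  also have "sum h {e \<in> E. snd e \<in> A \<and> fst e \<in> B} = (\<Sum>e\<in>E. of_bool (snd e \<in> A \<and> fst e \<in> B) * h e)"
    using finE by (subst sum.inter_filter, assumption, intro sum.cong) auto
  also have "sum f {e \<in> A \<times> B. fst e < snd e} = sum h {e \<in> E. fst e \<in> A \<and> snd e \<in> B}"
    using assms by (intro sum.cong) (force simp: f_def E_def)+
  also have "\<dots> = (\<Sum>e\<in>E. of_bool (fst e \<in> A \<and> snd e \<in> B) * h e)"
    using finE by (subst sum.inter_filter, assumption, intro sum.cong) auto
  finally show ?thesis
    by (simp add: pair_weight_def algebra_simps sum.distrib E_def)
qed

lemma sbm_concentration:
  fixes A B :: "(nat \<times> nat \<Rightarrow> bool) \<Rightarrow> nat set"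
  assumes par: "0 \<le> \<rho>" "\<rho> \<le> \<theta>" "\<theta> \<le> 1"
    and A: "\<And>g. A g \<subseteq> {..<n} - I" and B: "\<And>g. B g \<subseteq> {..<n} - I"
    and dep: "\<And>g g'. (\<And>u v. u < v \<Longrightarrow> v < n \<Longrightarrow> u \<in> I \<or> v \<in> I \<Longrightarrow> g (u, v) = g' (u, v))
      \<Longrightarrow> A g = A g' \<and> B g = B g'"
    and M: "M > 0" and a: "0 \<le> a" "a \<le> 2 * M"
  shows "measure_pmf.prob (sbm n z \<theta> \<rho>)
    {g. real (card (A g)) * real (card (B g)) * \<theta> \<le> M \<and>
        \<bar>(\<Sum>k\<in>A g. \<Sum>l\<in>B g. adjacency g k l) - (\<Sum>k\<in>A g. \<Sum>l\<in>B g. edge_mean z \<theta> \<rho> k l)\<bar> \<ge> a}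
    \<le> 2 * exp (- (a\<^sup>2 / (8 * M)))"
proof -
  define p where "p = (\<lambda>(i, j). if z i = z j then \<theta> else \<rho>)"
  define E1 where "E1 = {(i, j). i < j \<and> j < n \<and> (i \<in> I \<or> j \<in> I)}"
  define E2 where "E2 = {(i, j). i < j \<and> j < n \<and> i \<notin> I \<and> j \<notin> I}"
  have fin: "finite E1" "finite E2" unfolding E1_def E2_def
    by (rule finite_subset[OF _ finite_edges[of n]], auto)+
  have un: "{(i, j). i < j \<and> j < n} = E1 \<union> E2" by (auto simp: E1_def E2_def)
  have disj: "E1 \<inter> E2 = {}" by (auto simp: E1_def E2_def)
  have sbm: "sbm n z \<theta> \<rho> = Pi_pmf (E1 \<union> E2) False (\<lambda>e. bernoulli_pmf (p e))"
    unfolding sbm_def un p_def by (simp add: case_prod_unfold)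
  have pb: "0 \<le> p e \<and> p e \<le> 1" for e using par by (auto simp: p_def split: prod.splits)
  show ?thesis unfolding sbm
  proof (rule prob_Pi_pmf_union_le[OF fin disj])
    fix f :: "nat \<times> nat \<Rightarrow> bool"
    define hf where "hf g = (\<lambda>x. if x \<in> E1 then f x else g x)" for g
    define A0 where "A0 = A f"
    define B0 where "B0 = B f"
    \<comment> \<open>\<open>hf g\<close> agrees with \<open>f\<close> on every edge touching
      \<open>I\<close>, whatever \<open>g\<close> is.\<close>
    have AB: "A (hf g) = A0" "B (hf g) = B0" for g
      using dep[of "hf g" f] by (auto simp: A0_def B0_def hf_def E1_def)
    have A0: "A0 \<subseteq> {..<n} - I" "B0 \<subseteq> {..<n} - I" using A B by (auto simp: A0_def B0_def)
    have adj: "(\<Sum>k\<in>A0. \<Sum>l\<in>B0. adjacency (hf g) k l) = (\<Sum>e\<in>E2. pair_weight A0 B0 e * of_bool (g e))" for g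
    proof -
      have "(\<Sum>k\<in>A0. \<Sum>l\<in>B0. adjacency (hf g) k l)
          = (\<Sum>k\<in>A0. \<Sum>l\<in>B0. if k = l then 0 else of_bool (hf g (min k l, max k l)))"
        by (intro sum.cong) (auto simp: adjacency_def)
      also have "\<dots> = (\<Sum>e\<in>E2. pair_weight A0 B0 e * of_bool (hf g e))"
        unfolding E2_def by (rule sum_pair_weight[OF A0])
      also have "\<dots> = (\<Sum>e\<in>E2. pair_weight A0 B0 e * of_bool (g e))"
        using disj by (intro sum.cong) (auto simp: hf_def)
      finally show ?thesis .
    qed
    have mean: "(\<Sum>k\<in>A0. \<Sum>l\<in>B0. edge_mean z \<theta> \<rho> k l) = (\<Sum>e\<in>E2. pair_weight A0 B0 e * p e)"
    proof -
      have "(\<Sum>k\<in>A0. \<Sum>l\<in>B0. edge_mean z \<theta> \<rho> k l)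
          = (\<Sum>k\<in>A0. \<Sum>l\<in>B0. if k = l then 0 else p (min k l, max k l))"
        by (intro sum.cong) (auto simp: edge_mean_def p_def min_def max_def)
      also have "\<dots> = (\<Sum>e\<in>E2. pair_weight A0 B0 e * p e)"
        unfolding E2_def by (rule sum_pair_weight[OF A0])
      finally show ?thesis .
    qed
    show "measure_pmf.prob (Pi_pmf E2 False (\<lambda>e. bernoulli_pmf (p e)))
      {g. real (card (A (\<lambda>x. if x \<in> E1 then f x else g x))) * real (card (B (\<lambda>x. if x \<in> E1 then f x else g x))) * \<theta> \<le> M \<and>
          \<bar>(\<Sum>k\<in>A (\<lambda>x. if x \<in> E1 then f x else g x). \<Sum>l\<in>B (\<lambda>x. if x \<in> E1 then f x else g x).
              adjacency (\<lambda>x. if x \<in> E1 then f x else g x) k l)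
            - (\<Sum>k\<in>A (\<lambda>x. if x \<in> E1 then f x else g x). \<Sum>l\<in>B (\<lambda>x. if x \<in> E1 then f x else g x).
              edge_mean z \<theta> \<rho> k l)\<bar> \<ge> a} \<le> 2 * exp (- (a\<^sup>2 / (8 * M)))"
    proof (cases "real (card A0) * real (card B0) * \<theta> \<le> M")
      case True
      have "(\<Sum>k\<in>A0. \<Sum>l\<in>B0. edge_mean z \<theta> \<rho> k l) \<le> (\<Sum>k\<in>A0. \<Sum>l\<in>B0. \<theta>)"
        using par by (intro sum_mono) (auto simp: edge_mean_def)
      also have "\<dots> \<le> M" using True by simp
      finally have mu: "(\<Sum>e\<in>E2. pair_weight A0 B0 e * p e) \<le> M" by (simp add: mean)
      have ch: "measure_pmf.prob (Pi_pmf E2 False (\<lambda>e. bernoulli_pmf (p e)))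
        {g. \<bar>(\<Sum>e\<in>E2. pair_weight A0 B0 e * of_bool (g e)) - (\<Sum>e\<in>E2. pair_weight A0 B0 e * p e)\<bar> \<ge> a}
        \<le> 2 * exp (- (a\<^sup>2 / (8 * M)))"
        by (rule weighted_chernoff[OF fin(2) _ _ _ M a]) (use pb pair_weight_bounds mu in auto)
      show ?thesis unfolding hf_def[symmetric] AB adj mean using ch True by simp
    next
      case False
      then show ?thesis unfolding hf_def[symmetric] AB by simp
    qed
  qed auto
qed

subsection \<open>The test statistic in terms of the estimators\<close>

text \<open>The inequality \<open>ln x \<le> x - 1\<close> in both terms leaves the chi-square
  divergence of the two Bernoulli laws.\<close>

lemma KL_bernoulli_le:
  assumes "0 \<le> p" "p \<le> 1" "0 < q" "q < 1"
  shows "KL_bernoulli p q \<le> (p - q)\<^sup>2 / (q * (1 - q))"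
proof -
  have *: "x * ln (x / y) \<le> x * (x - y) / y" if "0 \<le> x" "0 < y" for x y :: real
  proof (cases "x = 0")
    case False
    then have "ln (x / y) \<le> x / y - 1" using that by (intro ln_le_minus_one) auto
    then have "x * ln (x / y) \<le> x * (x / y - 1)" using that by (intro mult_left_mono) auto
    then show ?thesis using that by (simp add: field_simps)
  qed auto
  have "KL_bernoulli p q \<le> p * (p - q) / q + (1 - p) * ((1 - p) - (1 - q)) / (1 - q)"
    unfolding KL_bernoulli_def using assms by (intro add_mono *) auto
  also have "\<dots> = (p - q)\<^sup>2 / (q * (1 - q))"
    using assms by (simp add: field_simps power2_eq_square)
  finally show ?thesis .
qed

text \<open>The bound compares the divergence with the squared Hellinger distance.\<close>

lemma KL_bernoulli_ge:
  assumes p: "0 < p" "p < 1" and q: "0 < q" "q < 1" and b: "p \<le> b" "q \<le> b"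
  shows "(p - q)\<^sup>2 / (4 * b) \<le> KL_bernoulli p q"
proof -
  have *: "x * ln (x / y) \<ge> 2 * x - 2 * sqrt (x * y)" if "0 < x" "0 < y" for x y :: real
  proof -
    have "ln (sqrt (y / x)) \<le> sqrt (y / x) - 1" using that by (intro ln_le_minus_one) auto
    moreover have "ln (sqrt (y / x)) = - ln (x / y) / 2"
      using that by (simp add: ln_sqrt ln_div)
    ultimately have "ln (x / y) \<ge> 2 - 2 * sqrt (y / x)" by simp
    then have "x * ln (x / y) \<ge> x * (2 - 2 * sqrt (y / x))" using that by (intro mult_left_mono) auto
    moreover have "x * sqrt (y / x) = sqrt (x * y)"
    proof -
      have "sqrt (x * y) = sqrt (x\<^sup>2 * (y / x))" using that by (simp add: power2_eq_square)
      also have "\<dots> = x * sqrt (y / x)" using that unfolding real_sqrt_mult by simp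
      finally show ?thesis by simp
    qed
    ultimately show ?thesis by (simp only: right_diff_distrib mult.left_commute mult.commute)
  qed
  have sq: "(sqrt x - sqrt y)\<^sup>2 = x + y - 2 * sqrt (x * y)" if "0 < x" "0 < y" for x y :: real
    using that by (simp add: power2_diff real_sqrt_mult)
  have bpos: "b > 0" using p b by simp
  have "KL_bernoulli p q \<ge> (2 * p - 2 * sqrt (p * q)) + (2 * (1 - p) - 2 * sqrt ((1 - p) * (1 - q)))"
    unfolding KL_bernoulli_def using *[OF p(1) q(1)] *[of "1 - p" "1 - q"] p q by linarith
  moreover have "(2 * p - 2 * sqrt (p * q)) + (2 * (1 - p) - 2 * sqrt ((1 - p) * (1 - q)))
      = (sqrt p - sqrt q)\<^sup>2 + (sqrt (1 - p) - sqrt (1 - q))\<^sup>2"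
    using sq[OF p(1) q(1)] sq[of "1 - p" "1 - q"] p q by simp
  ultimately have H: "KL_bernoulli p q \<ge> (sqrt p - sqrt q)\<^sup>2"
    using zero_le_power2[of "sqrt (1 - p) - sqrt (1 - q)"] by linarith
  \<comment> \<open>Splitting off \<open>sqrt p + sqrt q\<close> gains the factor
    1/\<open>b\<close>, with \<open>b\<close> later of order \<open>\<theta>\<close>. Pinsker's
    inequality would lose it and no longer match the upper bound for small
    \<open>\<theta>\<close>.\<close>
  have "(p - q)\<^sup>2 = (sqrt p - sqrt q)\<^sup>2 * (sqrt p + sqrt q)\<^sup>2"
  proof -
    have "(sqrt p - sqrt q) * (sqrt p + sqrt q) = p - q" using p q by (simp add: algebra_simps)
    then show ?thesis by (metis power_mult_distrib)
  qed
  also have "\<dots> \<le> KL_bernoulli p q * (4 * b)"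
  proof (rule mult_mono[OF H])
    have "sqrt p + sqrt q \<le> 2 * sqrt b" using b real_sqrt_le_mono[of p b] real_sqrt_le_mono[of q b] by linarith
    then have "(sqrt p + sqrt q)\<^sup>2 \<le> (2 * sqrt b)\<^sup>2" using p q by (intro power_mono) auto
    then show "(sqrt p + sqrt q)\<^sup>2 \<le> 4 * b" using bpos by (simp add: power_mult_distrib)
    show "0 \<le> KL_bernoulli p q" using H zero_le_power2 order_trans by blast
  qed auto
  finally show ?thesis using bpos by (simp add: divide_le_eq)
qed

lemma weighted_mean_bounds:
  fixes p1 p2 p3 w1 w2 w3 :: real
  assumes "w1 > 0" "w2 > 0" "w3 > 0"
    and "a \<le> p1" "a \<le> p2" "a \<le> p3" "p1 \<le> b" "p2 \<le> b" "p3 \<le> b"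
  shows "a \<le> (w1 * p1 + 2 * (w3 * p3) + w2 * p2) / (w1 + 2 * w3 + w2)"
    and "(w1 * p1 + 2 * (w3 * p3) + w2 * p2) / (w1 + 2 * w3 + w2) \<le> b"
proof -
  have pos: "w1 + 2 * w3 + w2 > 0" using assms by simp
  have "w1 * a \<le> w1 * p1" "w2 * a \<le> w2 * p2" "w3 * a \<le> w3 * p3"
    using assms by (auto intro: mult_left_mono)
  then show "a \<le> (w1 * p1 + 2 * (w3 * p3) + w2 * p2) / (w1 + 2 * w3 + w2)"
    using pos by (simp add: le_divide_eq algebra_simps)
  have "w1 * p1 \<le> w1 * b" "w2 * p2 \<le> w2 * b" "w3 * p3 \<le> w3 * b"
    using assms by (auto intro: mult_left_mono)
  then show "(w1 * p1 + 2 * (w3 * p3) + w2 * p2) / (w1 + 2 * w3 + w2) \<le> b"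
    using pos by (simp add: divide_le_eq algebra_simps)
qed

lemma theta_join_weighted:
  assumes "N_count n Y i i > 0" "N_count n Y j j > 0" "N_count n Y i j > 0"
  shows "theta_join n Y i j =
    (N_count n Y i i * theta_est n Y i i + 2 * (N_count n Y i j * theta_est n Y i j)
      + N_count n Y j j * theta_est n Y j j) / (N_count n Y i i + 2 * N_count n Y i j + N_count n Y j j)"
proof -
  have "N_count n Y i j * theta_est n Y i j = S_count n Y i j" if "N_count n Y i j > 0" for i j
    using that by (simp add: theta_est_def)
  then show ?thesis using assms by (simp add: theta_join_def S_join_def N_join_def)
qed

text \<open>The joint estimator is a weighted mean of the other three, so it is as close to
  \<open>p\<close> as they are. Each squared distance is then at most \<open>4 * \<Delta>^2\<close>,
  and three terms give 12.\<close>

lemma T_stat_le: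
  assumes N: "0 < N_count n Y i i" "N_count n Y i i \<le> Nhi" "0 < N_count n Y j j" "N_count n Y j j \<le> Nhi"
      "0 < N_count n Y i j" "N_count n Y i j \<le> Nhi"
    and close: "\<bar>theta_est n Y i i - p\<bar> \<le> \<Delta>" "\<bar>theta_est n Y j j - p\<bar> \<le> \<Delta>" "\<bar>theta_est n Y i j - p\<bar> \<le> \<Delta>"
    and lu: "0 < l" "l \<le> p - \<Delta>" "p + \<Delta> \<le> u" "u < 1"
  shows "T_stat n Y i j \<le> 12 * Nhi * \<Delta>\<^sup>2 / (l * (1 - u))"
proof -
  define q where "q = theta_join n Y i j"
  have q: "p - \<Delta> \<le> q" "q \<le> p + \<Delta>"
    unfolding q_def theta_join_weighted[OF N(1,3,5)]
    using weighted_mean_bounds[OF N(1,3,5), of "p - \<Delta>" "theta_est n Y i i" "theta_est n Y j j" "theta_est n Y i j" "p + \<Delta>"]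
      close by auto
  have "p \<ge> 0" "\<Delta> \<ge> 0" "Nhi \<ge> 0" using close lu N by linarith+
  have kl: "M * KL_bernoulli x q \<le> 4 * Nhi * \<Delta>\<^sup>2 / (l * (1 - u))"
    if "0 < M" "M \<le> Nhi" "\<bar>x - p\<bar> \<le> \<Delta>" for x M
  proof -
    have "KL_bernoulli x q \<le> (x - q)\<^sup>2 / (q * (1 - q))"
      using that q lu by (intro KL_bernoulli_le) auto
    also have "\<dots> \<le> (2 * \<Delta>)\<^sup>2 / (l * (1 - u))"
    proof (rule frac_le)
      show "(x - q)\<^sup>2 \<le> (2 * \<Delta>)\<^sup>2" using that q by (intro power2_mono) auto
      show "l * (1 - u) \<le> q * (1 - q)" using q lu by (intro mult_mono) auto
    qed (use lu in auto)
    finally have "M * KL_bernoulli x q \<le> M * ((2 * \<Delta>)\<^sup>2 / (l * (1 - u)))"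
      using that by (intro mult_left_mono) auto
    also have "\<dots> \<le> Nhi * ((2 * \<Delta>)\<^sup>2 / (l * (1 - u)))"
      using that lu by (intro mult_right_mono divide_nonneg_nonneg mult_nonneg_nonneg) auto
    finally show ?thesis by (simp add: power_mult_distrib mult.assoc mult.left_commute)
  qed
  \<comment> \<open>The conventional value 0 of an undefined statistic has to obey the bound as
    well.\<close>
  have "0 \<le> 12 * Nhi * \<Delta>\<^sup>2 / (l * (1 - u))"
    using lu \<open>Nhi \<ge> 0\<close> by (intro divide_nonneg_nonneg mult_nonneg_nonneg) auto
  moreover have "N_count n Y i i * KL_bernoulli (theta_est n Y i i) q
        + N_count n Y j j * KL_bernoulli (theta_est n Y j j) q
        + N_count n Y i j * KL_bernoulli (theta_est n Y i j) q \<le> 12 * Nhi * \<Delta>\<^sup>2 / (l * (1 - u))"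
    using kl[OF N(1,2) close(1)] kl[OF N(3,4) close(2)] kl[OF N(5,6) close(3)] by simp
  ultimately show ?thesis by (simp add: T_stat_def q_def)
qed

text \<open>With total weight 1 + 1 - 2 = 0 the combination in \<open>gap\<close> does not change
  when \<open>q\<close> is subtracted from each estimator. Hence one of the three is at distance at
  least \<open>G / 4\<close> from \<open>q\<close>, wherever \<open>q\<close> lies; the other two
  terms are nonnegative. The constant is 64 = 4 * 16.\<close>

lemma T_stat_ge:
  assumes N: "0 < Nlo" "Nlo \<le> N_count n Y i i" "Nlo \<le> N_count n Y j j" "Nlo \<le> N_count n Y i j"
    and range: "{theta_est n Y i i, theta_est n Y j j, theta_est n Y i j} \<subseteq> {l..u}"
    and lu: "0 < l" "u < 1" "u \<le> b"
    and gap: "theta_est n Y i i + theta_est n Y j j - 2 * theta_est n Y i j \<ge> G" "G \<ge> 0"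
  shows "T_stat n Y i j \<ge> Nlo * G\<^sup>2 / (64 * b)"
proof -
  define q where "q = theta_join n Y i j"
  have N': "0 < N_count n Y i i" "0 < N_count n Y j j" "0 < N_count n Y i j" using N by auto
  have q: "l \<le> q" "q \<le> u"
    unfolding q_def theta_join_weighted[OF N']
    using weighted_mean_bounds[OF N', of l "theta_est n Y i i" "theta_est n Y j j" "theta_est n Y i j" u]
      range by auto
  \<comment> \<open>Indispensable here: an undefined statistic would be 0.\<close>
  have defined: "T_defined n Y i j"
    using N' q range lu by (auto simp: T_defined_def N_join_def q_def)
  have b: "b > 0" using range lu by auto
  have kl: "M * KL_bernoulli x q \<ge> Nlo * ((x - q)\<^sup>2 / (4 * b))" if "Nlo \<le> M" "x \<in> {l..u}" for x M
    using that N q lu b by (intro mult_mono KL_bernoulli_ge) auto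
  have nonneg: "0 \<le> Nlo * ((x - q)\<^sup>2 / (4 * b))" for x using N b by simp
  have big: "Nlo * ((x - q)\<^sup>2 / (4 * b)) \<ge> Nlo * G\<^sup>2 / (64 * b)" if "\<bar>x - q\<bar> \<ge> G / 4" for x
  proof -
    have "(G / 4)\<^sup>2 \<le> (x - q)\<^sup>2" using that gap(2) by (simp add: abs_le_square_iff[symmetric])
    then have "Nlo * ((G / 4)\<^sup>2 / (4 * b)) \<le> Nlo * ((x - q)\<^sup>2 / (4 * b))"
      using N b by (intro mult_left_mono divide_right_mono) auto
    then show ?thesis by (simp add: power_divide)
  qed
  let ?p1 = "theta_est n Y i i" and ?p2 = "theta_est n Y j j" and ?p3 = "theta_est n Y i j"
  have "\<bar>?p1 - q\<bar> \<ge> G / 4 \<or> \<bar>?p2 - q\<bar> \<ge> G / 4 \<or> \<bar>?p3 - q\<bar> \<ge> G / 4" using gap by linarith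
  moreover have "T_stat n Y i j \<ge> Nlo * ((?p1 - q)\<^sup>2 / (4 * b)) + Nlo * ((?p2 - q)\<^sup>2 / (4 * b)) + Nlo * ((?p3 - q)\<^sup>2 / (4 * b))"
    using defined kl[OF N(2), of ?p1] kl[OF N(3), of ?p2] kl[OF N(4), of ?p3] range
    by (simp add: T_stat_def q_def)
  ultimately show ?thesis using big[of ?p1] big[of ?p2] big[of ?p3] nonneg[of ?p1] nonneg[of ?p2] nonneg[of ?p3]
    by linarith
qed

subsection \<open>Typical samples\<close>

lemma adjacency_basic:
  "adjacency g i j = adjacency g j i" "adjacency g i i = 0" "adjacency g i j \<in> {0, 1}"
  by (auto simp: adjacency_def min.commute max.commute)

lemma finite_nbhd [simp]: "finite (nbhd n Y i)"
  by (simp add: nbhd_def)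

lemma sum_adjacency:
  "(\<Sum>k<n. adjacency g i k * f k) = (\<Sum>k\<in>nbhd n (adjacency g) i. f k)"
proof -
  have "(\<Sum>k<n. adjacency g i k * f k) = (\<Sum>k<n. if adjacency g i k = 1 then f k else 0)"
    using adjacency_basic(3)[of g i] by (intro sum.cong) auto
  also have "\<dots> = (\<Sum>k\<in>nbhd n (adjacency g) i. f k)"
    unfolding nbhd_def by (subst sum.inter_filter) auto
  finally show ?thesis .
qed

text \<open>The correction term of \<open>S_count\<close> removes exactly the walks \<open>i, j, l, j\<close> and \<open>i, k, i, j\<close>.\<close>

lemma S_count_adjacency:
  assumes "i < n" "j < n"
  shows "S_count n (adjacency g) i j =
    (\<Sum>k\<in>nbhd n (adjacency g) i - {j}. \<Sum>l\<in>nbhd n (adjacency g) j - {i}. adjacency g k l)"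
proof -
  let ?Y = "adjacency g"
  define A where "A = nbhd n ?Y i"
  define B where "B = nbhd n ?Y j"
  have fin: "finite A" "finite B" by (auto simp: A_def B_def)
  have "(\<Sum>k<n. \<Sum>l<n. ?Y i k * ?Y k l * ?Y l j) = (\<Sum>k<n. ?Y i k * (\<Sum>l<n. ?Y j l * ?Y k l))"
    by (simp add: sum_distrib_left mult_ac adjacency_basic(1)[of g _ j])
  also have "\<dots> = (\<Sum>k\<in>A. \<Sum>l\<in>B. ?Y k l)" by (simp add: sum_adjacency A_def B_def)
  finally have walks: "(\<Sum>k<n. \<Sum>l<n. ?Y i k * ?Y k l * ?Y l j) = (\<Sum>k\<in>A. \<Sum>l\<in>B. ?Y k l)" .
  show ?thesis
  proof (cases "?Y i j = 1")
    case True
    then have mem: "j \<in> A" "i \<in> B" using assms adjacency_basic(1)[of g i j] by (auto simp: A_def B_def nbhd_def)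
    have "i \<noteq> j" using True adjacency_basic(2)[of g i] by auto
    have row: "(\<Sum>l\<in>B. ?Y j l) = real (card B)"
      by (simp add: B_def nbhd_def)
    \<comment> \<open>The walk \<open>i, j, i, j\<close> belongs to both removed families and has
      already gone with the row of \<open>j\<close>, hence the \<open>- 1\<close>.\<close>
    have col: "(\<Sum>k\<in>A - {j}. ?Y k i) = real (card A) - 1"
    proof -
      have "(\<Sum>k\<in>A - {j}. ?Y k i) = real (card (A - {j}))"
        using adjacency_basic(1)[of g i] by (simp add: A_def nbhd_def)
      also have "\<dots> = real (card A) - 1" using mem fin card_gt_0_iff[of A] by (auto simp: card_Diff_singleton of_nat_diff)
      finally show ?thesis .
    qed
    have "(\<Sum>k\<in>A. \<Sum>l\<in>B. ?Y k l) = real (card B) + (\<Sum>k\<in>A - {j}. \<Sum>l\<in>B. ?Y k l)"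
      using mem fin by (subst sum.remove[of A j]) (simp_all add: row)
    also have "(\<Sum>k\<in>A - {j}. \<Sum>l\<in>B. ?Y k l) = (\<Sum>k\<in>A - {j}. ?Y k i + (\<Sum>l\<in>B - {i}. ?Y k l))"
      using mem fin by (intro sum.cong refl sum.remove)
    also have "\<dots> = real (card A) - 1 + (\<Sum>k\<in>A - {j}. \<Sum>l\<in>B - {i}. ?Y k l)"
      by (simp add: sum.distrib col)
    finally show ?thesis
      unfolding S_count_def walks using True by (simp add: A_def B_def)
  next
    case False
    then have "j \<notin> A" "i \<notin> B" using adjacency_basic(1)[of g i j] by (auto simp: A_def B_def nbhd_def)
    then have "A - {j} = A" "B - {i} = B" by auto
    then show ?thesis unfolding S_count_def walks using False by (simp add: A_def B_def)
  qed
qed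

lemma sum_remove_bounds:
  fixes f :: "'a \<Rightarrow> real"
  assumes "finite A" "0 \<le> c" "\<And>x. x \<in> A \<Longrightarrow> 0 \<le> f x \<and> f x \<le> c"
  shows "0 \<le> sum f A - sum f (A - {a}) \<and> sum f A - sum f (A - {a}) \<le> c"
proof (cases "a \<in> A")
  case True
  then have "sum f A = f a + sum f (A - {a})" using assms(1) by (rule sum.remove[rotated])
  then show ?thesis using assms(3)[OF True] by auto
qed (use assms in auto)

text \<open>
  \<open>mn\<close> and \<open>mx\<close> bound the community sizes, \<open>\<eta>\<close> the fluctuations of the degrees into a community,
  and \<open>\<zeta>\<close> the fluctuations of the edge counts between two neighbourhoods. The size premise in
  \<open>cross_conc\<close> is there because the tail bound is conditional on the neighbourhoods; the degree
  bounds that follow from \<open>deg_conc\<close> discharge it.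
\<close>

locale typical_sample =
  fixes n K :: nat and z :: "nat \<Rightarrow> nat" and \<theta> \<rho> C mn mx \<eta> \<zeta> :: real and g :: "nat \<times> nat \<Rightarrow> bool"
  assumes labels: "\<And>i. i < n \<Longrightarrow> z i < K"
    and par: "0 < \<rho>" "\<rho> < \<theta>" "\<theta> \<le> 1" "\<theta> \<le> C * \<rho>" "1 \<le> C"
    and sizes: "\<And>a. a < K \<Longrightarrow> mn \<le> real (card (community n z a)) \<and> real (card (community n z a)) \<le> mx"
    and mx_le: "mx \<le> real n" and mn: "0 < mn" "mn \<le> mx"
    and deg_conc: "\<And>i a. i < n \<Longrightarrow> a < K \<Longrightarrow>
      \<bar>(\<Sum>l\<in>community n z a. adjacency g i l) - (\<Sum>l\<in>community n z a. edge_mean z \<theta> \<rho> i l)\<bar> \<le> \<eta>"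
    and cross_conc: "\<And>i j. i < n \<Longrightarrow> j < n \<Longrightarrow>
      real (card (nbhd n (adjacency g) i - {j})) * real (card (nbhd n (adjacency g) j - {i})) * \<theta>
        \<le> (2 * real K * (\<theta> * mx))\<^sup>2 * \<theta> \<Longrightarrow>
      \<bar>(\<Sum>k\<in>nbhd n (adjacency g) i - {j}. \<Sum>l\<in>nbhd n (adjacency g) j - {i}. adjacency g k l)
       - (\<Sum>k\<in>nbhd n (adjacency g) i - {j}. \<Sum>l\<in>nbhd n (adjacency g) j - {i}. edge_mean z \<theta> \<rho> k l)\<bar> \<le> \<zeta>"
    and eta: "1 \<le> \<eta>" and sep: "48 * real K * C * \<eta> \<le> mn * (\<theta> - \<rho>)"
begin

section \<open>Degrees and the composition of a single neighbourhood\<close>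

definition "nb i = nbhd n (adjacency g) i"
definition "dg i = real (card (nb i))"
definition "dc i a = real (card (nb i \<inter> community n z a))"
definition "csize a = real (card (community n z a))"
definition "share i a = dc i a / dg i"
text \<open>The probability that a random neighbour of \<open>i\<close> and a random neighbour of
  \<open>j\<close> are joined, if equal vertices are treated like any pair of one community; see
  \<open>sum_link\<close>. It is the value that \<open>theta_est\<close> estimates.\<close>

definition "block_mean i j = \<rho> + (\<theta> - \<rho>) * (\<Sum>a<K. share i a * share j a)"
definition "link a b = (if a = b then \<theta> else \<rho>)" for a b :: nat
text \<open>Fluctuation \<open>\<zeta>\<close> plus bias of \<open>S_count\<close>, divided by the
  lower bound \<open>\<theta>^2 * mx^2 / (8 * C^2)\<close> for \<open>N_count\<close>.\<close>

definition "err = 8 * C\<^sup>2 * (\<zeta> + 6 * real K * \<theta>\<^sup>2 * mx) / (\<theta>\<^sup>2 * mx\<^sup>2)"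

lemma nb_simps: "finite (nb i)" "nb i \<subseteq> {..<n}" "i \<notin> nb i"
  using adjacency_basic(2)[of g i] by (auto simp: nb_def nbhd_def)

lemma finite_community [simp]: "finite (community n z a)" by (simp add: community_def)

lemma sum_by_community:
  fixes f :: "nat \<Rightarrow> real"
  assumes "A \<subseteq> {..<n}"
  shows "(\<Sum>k\<in>A. f (z k)) = (\<Sum>a<K. real (card (A \<inter> community n z a)) * f a)"
proof -
  have fin: "finite A" using assms by (rule finite_subset) simp
  have "(\<Sum>k\<in>A. f (z k)) = (\<Sum>a<K. \<Sum>k\<in>{k\<in>A. z k = a}. f (z k))"
    using assms labels fin by (intro sum.group[symmetric]) auto
  also have "\<dots> = (\<Sum>a<K. \<Sum>k\<in>A \<inter> community n z a. f a)"
    using assms by (intro sum.cong) (auto simp: community_def)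
  finally show ?thesis by simp
qed

lemma dg_eq: "dg i = (\<Sum>a<K. dc i a)"
  using sum_by_community[OF nb_simps(2), of "\<lambda>_. 1" i] by (simp add: dg_def dc_def)

lemma n_eq: "real n = (\<Sum>a<K. csize a)"
proof -
  have "{..<n} \<inter> community n z a = community n z a" for a by (auto simp: community_def)
  then show ?thesis using sum_by_community[of "{..<n}" "\<lambda>_. 1"] by (simp add: csize_def)
qed

lemma dc_bounds: "0 \<le> dc i a" "dc i a \<le> dg i"
  using nb_simps(1)[of i] by (auto simp: dc_def dg_def intro!: card_mono)

lemma dc_sum: "dc i a = (\<Sum>l\<in>community n z a. adjacency g i l)"
proof -
  have "dc i a = (\<Sum>l\<in>nb i. if l \<in> community n z a then 1 else 0)"
    using nb_simps(1)[of i] by (simp add: dc_def sum.If_cases Int_def)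
  also have "\<dots> = (\<Sum>l<n. adjacency g i l * (if l \<in> community n z a then 1 else 0))"
    by (simp add: sum_adjacency nb_def)
  also have "\<dots> = (\<Sum>l<n. if l \<in> community n z a then adjacency g i l else 0)"
    by (intro sum.cong) auto
  also have "\<dots> = (\<Sum>l\<in>community n z a. adjacency g i l)"
    by (subst sum.inter_filter[symmetric]) (auto simp: community_def intro!: sum.cong)
  finally show ?thesis .
qed

lemma mean_into_community:
  assumes "i < n"
  shows "(\<Sum>l\<in>community n z a. edge_mean z \<theta> \<rho> i l) = csize a * link (z i) a - (if a = z i then \<theta> else 0)"
proof -
  have "(\<Sum>l\<in>community n z a. edge_mean z \<theta> \<rho> i l)
      = (\<Sum>l\<in>community n z a. link (z i) a - (if l = i then \<theta> else 0))"
    using par by (intro sum.cong) (auto simp: edge_mean_def link_def community_def)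
  also have "\<dots> = csize a * link (z i) a - (\<Sum>l\<in>community n z a. if l = i then \<theta> else 0)"
    by (simp add: sum_subtractf csize_def)
  also have "(\<Sum>l\<in>community n z a. if l = i then \<theta> else 0) = (if a = z i then \<theta> else 0)"
    using assms by (auto simp: community_def)
  finally show ?thesis .
qed

text \<open>One \<open>\<eta>\<close> is for the fluctuation, the other covers the missing diagonal
  entry, which costs at most \<open>\<theta> \<le> 1 \<le> \<eta>\<close>.\<close>

lemma dc_close:
  assumes "i < n" "a < K"
  shows "\<bar>dc i a - csize a * link (z i) a\<bar> \<le> 2 * \<eta>"
  using deg_conc[OF assms] eta par unfolding dc_sum mean_into_community[OF assms(1)]
  by (auto split: if_splits)

text \<open>The mean depends on the vertex only through its label, diagonal correction included, so
  only the two fluctuations remain.\<close>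

lemma dc_same:
  assumes "i < n" "j < n" "z i = z j" "a < K"
  shows "\<bar>dc i a - dc j a\<bar> \<le> 2 * \<eta>"
  using deg_conc[OF assms(1,4)] deg_conc[OF assms(2,4)] assms(3)
  unfolding dc_sum mean_into_community[OF assms(1)] mean_into_community[OF assms(2)]
  by auto

lemma dg_same:
  assumes "i < n" "j < n" "z i = z j"
  shows "\<bar>dg i - dg j\<bar> \<le> 2 * real K * \<eta>"
proof -
  have "\<bar>dg i - dg j\<bar> \<le> (\<Sum>a<K. \<bar>dc i a - dc j a\<bar>)"
    unfolding dg_eq sum_subtractf[symmetric] by (rule sum_abs)
  also have "\<dots> \<le> (\<Sum>a<K. 2 * \<eta>)" using dc_same[OF assms] by (intro sum_mono) auto
  finally show ?thesis by simp
qed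

lemma dg_close:
  assumes "i < n"
  shows "\<bar>dg i - (\<rho> * real n + (\<theta> - \<rho>) * csize (z i))\<bar> \<le> 2 * real K * \<eta>"
proof -
  have "(\<Sum>a<K. csize a * link (z i) a) = (\<Sum>a<K. \<rho> * csize a + (if a = z i then (\<theta> - \<rho>) * csize (z i) else 0))"
    by (intro sum.cong) (auto simp: link_def algebra_simps)
  also have "\<dots> = \<rho> * real n + (\<theta> - \<rho>) * csize (z i)"
    using labels[OF assms] by (simp add: sum.distrib n_eq sum_distrib_left)
  finally have "\<bar>dg i - (\<rho> * real n + (\<theta> - \<rho>) * csize (z i))\<bar> = \<bar>\<Sum>a<K. dc i a - csize a * link (z i) a\<bar>"
    by (simp add: dg_eq sum_subtractf)
  also have "\<dots> \<le> (\<Sum>a<K. \<bar>dc i a - csize a * link (z i) a\<bar>)" by (rule sum_abs)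
  also have "\<dots> \<le> (\<Sum>a<K. 2 * \<eta>)" using dc_close[OF assms] by (intro sum_mono) auto
  finally show ?thesis by simp
qed

lemma K_pos: "i < n \<Longrightarrow> 1 \<le> real K" using labels[of i] by simp

text \<open>Since \<open>mn * (\<theta> - \<rho>) \<le> mx * \<theta>\<close>, the assumption
  \<open>sep\<close> also makes \<open>\<eta>\<close> small against the degrees. The forms with
  division by \<open>C\<close> are needed because the ratio assumption guarantees expected degrees
  only of order \<open>\<theta> * mx / C\<close>.\<close>

lemma scale_bounds:
  assumes "i < n"
  shows "48 * real K * C * \<eta> \<le> \<theta> * mx" "48 * real K * \<eta> \<le> \<theta> * mx / C" "48 \<le> \<theta> * mx / C"
proof -
  have "mn * (\<theta> - \<rho>) \<le> mx * \<theta>" using mn par by (intro mult_mono) auto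
  then show 1: "48 * real K * C * \<eta> \<le> \<theta> * mx" using sep by (simp add: mult.commute)
  show 2: "48 * real K * \<eta> \<le> \<theta> * mx / C" using 1 par by (simp add: le_divide_eq algebra_simps)
  have "1 * 1 \<le> real K * \<eta>" using K_pos[OF assms] eta by (intro mult_mono) auto
  then show "48 \<le> \<theta> * mx / C" using 2 by simp
qed

lemma dg_lower:
  assumes "i < n"
  shows "\<theta> * mx / (2 * C) \<le> dg i"
proof -
  have "\<theta> * mx / C \<le> \<rho> * mx"
    using par mn by (simp add: divide_le_eq) (metis mult.assoc mult.commute mult_right_mono less_imp_le order.trans)
  also have "\<dots> \<le> \<rho> * real n" using par mx_le by simp
  also have "\<dots> \<le> \<rho> * real n + (\<theta> - \<rho>) * csize (z i)" using par by (simp add: csize_def)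
  finally have "\<theta> * mx / C - 2 * real K * \<eta> \<le> dg i" using dg_close[OF assms] by linarith
  moreover have "2 * (2 * real K * \<eta>) \<le> \<theta> * mx / C"
  proof -
    have "0 \<le> real K * \<eta>" using eta by simp
    then show ?thesis using scale_bounds(2)[OF assms] by linarith
  qed
  moreover have "\<theta> * mx / (2 * C) = \<theta> * mx / C / 2" by simp
  ultimately show ?thesis by linarith
qed

lemma dg_upper:
  assumes "i < n"
  shows "dg i \<le> 2 * real K * (\<theta> * mx)"
proof -
  have "dc i a \<le> 2 * (\<theta> * mx)" if "a < K" for a
  proof -
    have "csize a * link (z i) a \<le> mx * \<theta>"
      using sizes[OF that] par mn by (intro mult_mono) (auto simp: link_def csize_def)
    moreover have "2 * \<eta> \<le> \<theta> * mx"
    proof -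
      have "1 * 1 * \<eta> \<le> real K * C * \<eta>" using K_pos[OF assms] par eta by (intro mult_mono) auto
      then show ?thesis using scale_bounds(1)[OF assms] eta by (simp only: mult.assoc)
    qed
    ultimately show ?thesis using dc_close[OF assms that] by (simp add: mult.commute)
  qed
  then have "dg i \<le> (\<Sum>a<K. 2 * (\<theta> * mx))" unfolding dg_eq by (intro sum_mono) auto
  then show ?thesis by simp
qed

lemma dg_ge_2: "i < n \<Longrightarrow> 2 \<le> dg i"
  using dg_lower[of i] scale_bounds(3)[of i] by simp

lemma share_props:
  assumes "i < n"
  shows "0 \<le> share i a" "share i a \<le> 1" "(\<Sum>a<K. share i a) = 1"
  unfolding atomize_conj using dg_ge_2[OF assms] dc_bounds[of i a] by (auto simp: share_def sum_divide_distrib[symmetric] dg_eq[symmetric])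

section \<open>Bias and fluctuation of the estimators\<close>

lemma block_mean_bounds:
  assumes "i < n" "j < n"
  shows "\<rho> \<le> block_mean i j" "block_mean i j \<le> \<theta>"
proof -
  have "0 \<le> (\<Sum>a<K. share i a * share j a)" using share_props assms by (intro sum_nonneg) auto
  then show "\<rho> \<le> block_mean i j" using par by (simp add: block_mean_def)
  have "(\<Sum>a<K. share i a * share j a) \<le> (\<Sum>a<K. share i a * 1)"
    using share_props assms by (intro sum_mono mult_left_mono) auto
  then have "(\<Sum>a<K. share i a * share j a) \<le> 1" using share_props(3)[OF assms(1)] by simp
  then have "(\<theta> - \<rho>) * (\<Sum>a<K. share i a * share j a) \<le> (\<theta> - \<rho>) * 1" using par by (intro mult_left_mono) auto
  then show "block_mean i j \<le> \<theta>" by (simp add: block_mean_def)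
qed

text \<open>Keeping the diagonal pairs and the vertices \<open>i\<close>, \<open>j\<close>
  themselves makes the average factor exactly through the shares. What this adds is subtracted in
  \<open>S_count_close\<close>.\<close>

lemma sum_link:
  assumes "i < n" "j < n"
  shows "(\<Sum>k\<in>nb i. \<Sum>l\<in>nb j. link (z k) (z l)) = block_mean i j * (dg i * dg j)"
proof -
  have inner: "(\<Sum>l\<in>nb j. link a (z l)) = \<rho> * dg j + (\<theta> - \<rho>) * dc j a" if "a < K" for a
  proof -
    have "(\<Sum>l\<in>nb j. link a (z l)) = (\<Sum>b<K. dc j b * link a b)"
      using sum_by_community[OF nb_simps(2), of "link a"] by (simp add: dc_def)
    also have "\<dots> = (\<Sum>b<K. \<rho> * dc j b + (if b = a then (\<theta> - \<rho>) * dc j a else 0))"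
      by (intro sum.cong) (auto simp: link_def algebra_simps)
    finally show ?thesis using that by (simp add: sum.distrib dg_eq sum_distrib_left)
  qed
  have "(\<Sum>k\<in>nb i. \<Sum>l\<in>nb j. link (z k) (z l)) = (\<Sum>a<K. dc i a * (\<Sum>l\<in>nb j. link a (z l)))"
    using sum_by_community[OF nb_simps(2), of "\<lambda>a. \<Sum>l\<in>nb j. link a (z l)"] by (simp add: dc_def)
  also have "\<dots> = (\<Sum>a<K. \<rho> * dg j * dc i a + (\<theta> - \<rho>) * (dc i a * dc j a))"
    by (intro sum.cong) (auto simp: inner algebra_simps)
  also have "\<dots> = \<rho> * (dg i * dg j) + (\<theta> - \<rho>) * (\<Sum>a<K. dc i a * dc j a)"
    by (simp add: sum.distrib sum_distrib_left[symmetric] dg_eq[symmetric])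
  also have "(\<Sum>a<K. dc i a * dc j a) = (\<Sum>a<K. share i a * share j a) * (dg i * dg j)"
    using dg_ge_2[OF assms(1)] dg_ge_2[OF assms(2)]
    by (simp add: share_def sum_distrib_right)
  finally show ?thesis by (simp add: block_mean_def algebra_simps)
qed

text \<open>Write \<open>D\<close> for the degree bound. Besides the fluctuation
  \<open>\<zeta>\<close> there is a bias: dropping \<open>j\<close> from the first set costs at most
  \<open>D * \<theta>\<close>, and in each row dropping \<open>i\<close> and the zero diagonal cost
  at most \<open>\<theta>\<close> each. The total \<open>3 * D * \<theta>\<close> is the term
  \<open>6 * real K * \<theta>^2 * mx\<close>.\<close>

lemma S_count_close:
  assumes ij: "i < n" "j < n"
  shows "\<bar>S_count n (adjacency g) i j - block_mean i j * N_count n (adjacency g) i j\<bar>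
    \<le> \<zeta> + 6 * real K * \<theta>\<^sup>2 * mx"
proof -
  define A where "A = nb i"
  define B where "B = nb j"
  define D where "D = 2 * real K * (\<theta> * mx)"
  have fin: "finite A" "finite B" by (auto simp: A_def B_def nb_simps)
  have cd: "real (card A) \<le> D" "real (card B) \<le> D" "real (card (A - {j})) \<le> D" "real (card (B - {i})) \<le> D"
  proof -
    show "real (card A) \<le> D" and 1: "real (card B) \<le> D"
      using dg_upper ij by (auto simp: A_def B_def D_def dg_def)
    then show "real (card (A - {j})) \<le> D" using card_Diff1_le[of A j] by linarith
    show "real (card (B - {i})) \<le> D" using 1 card_Diff1_le[of B i] by linarith
  qed
  have lk: "0 \<le> link a b \<and> link a b \<le> \<theta>" for a b using par by (auto simp: link_def)
  have c1: "0 \<le> (\<Sum>k\<in>A. \<Sum>l\<in>B. link (z k) (z l)) - (\<Sum>k\<in>A - {j}. \<Sum>l\<in>B. link (z k) (z l))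
     \<and> (\<Sum>k\<in>A. \<Sum>l\<in>B. link (z k) (z l)) - (\<Sum>k\<in>A - {j}. \<Sum>l\<in>B. link (z k) (z l)) \<le> D * \<theta>"
  proof (rule sum_remove_bounds[OF fin(1)])
    fix k
    have "(\<Sum>l\<in>B. link (z k) (z l)) \<le> (\<Sum>l\<in>B. \<theta>)" using lk by (intro sum_mono) auto
    also have "\<dots> \<le> D * \<theta>" using cd par by (simp add: mult_right_mono)
    finally show "0 \<le> (\<Sum>l\<in>B. link (z k) (z l)) \<and> (\<Sum>l\<in>B. link (z k) (z l)) \<le> D * \<theta>"
      using lk by (auto intro: sum_nonneg)
  qed (use par mn in \<open>simp add: D_def\<close>)
  have row: "0 \<le> (\<Sum>l\<in>B. link (z k) (z l)) - (\<Sum>l\<in>B - {i}. edge_mean z \<theta> \<rho> k l)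
     \<and> (\<Sum>l\<in>B. link (z k) (z l)) - (\<Sum>l\<in>B - {i}. edge_mean z \<theta> \<rho> k l) \<le> 2 * \<theta>" for k
  proof -
    have 1: "0 \<le> (\<Sum>l\<in>B. link (z k) (z l)) - (\<Sum>l\<in>B - {i}. link (z k) (z l))
      \<and> (\<Sum>l\<in>B. link (z k) (z l)) - (\<Sum>l\<in>B - {i}. link (z k) (z l)) \<le> \<theta>"
      using fin lk par by (intro sum_remove_bounds) auto
    have "(\<Sum>l\<in>B - {i}. link (z k) (z l)) - (\<Sum>l\<in>B - {i}. edge_mean z \<theta> \<rho> k l)
       = (\<Sum>l\<in>B - {i}. if l = k then \<theta> else 0)"
      unfolding sum_subtractf[symmetric] by (intro sum.cong) (auto simp: edge_mean_def link_def)
    also have "\<dots> = (if k \<in> B - {i} then \<theta> else 0)" using fin by simp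
    finally show ?thesis using 1 par by (auto split: if_splits)
  qed
  have c2: "0 \<le> (\<Sum>k\<in>A - {j}. \<Sum>l\<in>B. link (z k) (z l)) - (\<Sum>k\<in>A - {j}. \<Sum>l\<in>B - {i}. edge_mean z \<theta> \<rho> k l)
     \<and> (\<Sum>k\<in>A - {j}. \<Sum>l\<in>B. link (z k) (z l)) - (\<Sum>k\<in>A - {j}. \<Sum>l\<in>B - {i}. edge_mean z \<theta> \<rho> k l) \<le> D * (2 * \<theta>)"
  proof -
    have "(\<Sum>k\<in>A - {j}. (\<Sum>l\<in>B. link (z k) (z l)) - (\<Sum>l\<in>B - {i}. edge_mean z \<theta> \<rho> k l)) \<le> (\<Sum>k\<in>A - {j}. 2 * \<theta>)"
      using row by (intro sum_mono) auto
    also have "\<dots> = real (card (A - {j})) * (2 * \<theta>)" by simp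
    also have "\<dots> \<le> D * (2 * \<theta>)" using cd(3) par by (intro mult_right_mono) auto
    finally show ?thesis using row by (auto simp: sum_subtractf[symmetric] intro: sum_nonneg)
  qed
  define rem where "rem = block_mean i j * (dg i * dg j) - (\<Sum>k\<in>A - {j}. \<Sum>l\<in>B - {i}. edge_mean z \<theta> \<rho> k l)"
  have rem: "0 \<le> rem" "rem \<le> 3 * (D * \<theta>)"
    using c1 c2 unfolding rem_def sum_link[OF ij, symmetric] A_def[symmetric] B_def[symmetric] by linarith+
  have D3: "3 * (D * \<theta>) = 6 * real K * \<theta>\<^sup>2 * mx" by (simp add: D_def power2_eq_square)
  have S: "\<bar>S_count n (adjacency g) i j - (\<Sum>k\<in>A - {j}. \<Sum>l\<in>B - {i}. edge_mean z \<theta> \<rho> k l)\<bar> \<le> \<zeta>"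
    unfolding S_count_adjacency[OF ij] A_def B_def nb_def
  proof (rule cross_conc[OF ij])
    have "real (card (A - {j})) * real (card (B - {i})) \<le> D * D"
      using cd by (intro mult_mono) auto
    then show "real (card (nbhd n (adjacency g) i - {j})) * real (card (nbhd n (adjacency g) j - {i})) * \<theta>
        \<le> (2 * real K * (\<theta> * mx))\<^sup>2 * \<theta>"
      using par by (intro mult_right_mono) (auto simp: A_def B_def nb_def D_def power2_eq_square)
  qed
  define loop where "loop = block_mean i j * (dg i * (if i = j then 1 else 0))"
  have N: "block_mean i j * N_count n (adjacency g) i j = block_mean i j * (dg i * dg j) - loop"
    by (simp add: N_count_def dg_def nb_def loop_def algebra_simps)
  have "0 \<le> dg i" "dg i \<le> D" using dg_upper ij dg_ge_2[OF ij(1)] by (auto simp: D_def)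
  have "dg i * (if i = j then 1 else 0) \<le> D" using \<open>0 \<le> dg i\<close> \<open>dg i \<le> D\<close> by auto
  then have "loop \<le> \<theta> * D" "0 \<le> loop" unfolding loop_def
    using block_mean_bounds[OF ij] par \<open>0 \<le> dg i\<close> by (auto intro!: mult_mono)
  moreover have "0 \<le> \<theta> * D" using calculation by linarith
  \<comment> \<open>Both corrections are nonnegative, so their difference needs no more room than
    the larger bound.\<close>
  ultimately have "\<bar>loop - rem\<bar> \<le> 3 * (D * \<theta>)" using rem by (simp add: mult.commute)
  then show ?thesis using S unfolding N D3[symmetric] rem_def by linarith
qed

lemma N_count_bounds:
  assumes ij: "i < n" "j < n"
  shows "\<theta>\<^sup>2 * mx\<^sup>2 / (8 * C\<^sup>2) \<le> N_count n (adjacency g) i j"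
    "N_count n (adjacency g) i j \<le> 4 * (real K)\<^sup>2 * (\<theta>\<^sup>2 * mx\<^sup>2)"
proof -
  have N: "N_count n (adjacency g) i j = dg i * (dg j - (if i = j then 1 else 0))"
    by (simp add: N_count_def dg_def nb_def)
  have "\<theta>\<^sup>2 * mx\<^sup>2 / (8 * C\<^sup>2) = (\<theta> * mx / (2 * C)) * ((\<theta> * mx / (2 * C)) / 2)"
    by (simp add: power2_eq_square)
  also have "\<dots> \<le> dg i * (dg j / 2)"
    using dg_lower[OF ij(1)] dg_lower[OF ij(2)] dg_ge_2[OF ij(1)] par mn by (intro mult_mono divide_right_mono) auto
  \<comment> \<open>For \<open>i = j\<close> the subtracted 1 is at most half of the degree, because
    degrees are at least 2.\<close>
  also have "\<dots> \<le> dg i * (dg j - (if i = j then 1 else 0))"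
    using dg_ge_2[OF ij(1)] dg_ge_2[OF ij(2)] by (intro mult_left_mono) auto
  finally show "\<theta>\<^sup>2 * mx\<^sup>2 / (8 * C\<^sup>2) \<le> N_count n (adjacency g) i j" by (simp add: N)
  have "dg i * (dg j - (if i = j then 1 else 0)) \<le> (2 * real K * (\<theta> * mx)) * (2 * real K * (\<theta> * mx))"
    using dg_upper[OF ij(1)] dg_upper[OF ij(2)] dg_ge_2[OF ij(1)] dg_ge_2[OF ij(2)] par mn by (intro mult_mono) auto
  then show "N_count n (adjacency g) i j \<le> 4 * (real K)\<^sup>2 * (\<theta>\<^sup>2 * mx\<^sup>2)"
    by (simp add: N power2_eq_square mult_ac)
qed

lemma N_count_pos: "i < n \<Longrightarrow> j < n \<Longrightarrow> 0 < N_count n (adjacency g) i j"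
  using N_count_bounds(1)[of i j] par mn
  by (smt (verit) divide_pos_pos mult_pos_pos zero_less_power)

lemma theta_est_close:
  assumes ij: "i < n" "j < n"
  shows "\<bar>theta_est n (adjacency g) i j - block_mean i j\<bar> \<le> err"
proof -
  define N where "N = N_count n (adjacency g) i j"
  define lo where "lo = \<theta>\<^sup>2 * mx\<^sup>2 / (8 * C\<^sup>2)"
  have lo: "0 < lo" using par mn by (simp add: lo_def)
  have N: "lo \<le> N" "0 < N" using N_count_bounds(1)[OF ij] lo by (auto simp: N_def lo_def)
  have "theta_est n (adjacency g) i j - block_mean i j = (S_count n (adjacency g) i j - block_mean i j * N) / N"
    using N(2) by (simp add: theta_est_def N_def field_simps)
  then have "\<bar>theta_est n (adjacency g) i j - block_mean i j\<bar> = \<bar>S_count n (adjacency g) i j - block_mean i j * N\<bar> / N"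
    using N(2) by (simp add: abs_divide)
  also have "\<dots> \<le> (\<zeta> + 6 * real K * \<theta>\<^sup>2 * mx) / lo"
    using S_count_close[OF ij] N lo by (intro frac_le) (auto simp: N_def)
  also have "\<dots> = err" by (simp add: err_def lo_def)
  finally show ?thesis .
qed

section \<open>Comparing the compositions of two neighbourhoods\<close>

lemma share_same:
  assumes "i < n" "j < n" "z i = z j" "a < K"
  shows "\<bar>share i a - share j a\<bar> \<le> 8 * real K * C * \<eta> / (\<theta> * mx)"
proof -
  note dgs = dg_ge_2[OF assms(1)] dg_ge_2[OF assms(2)]
  have "\<bar>dc i a * dg j - dc j a * dg i\<bar> = \<bar>(dc i a - dc j a) * dg j + dc j a * (dg j - dg i)\<bar>"
    by (simp add: algebra_simps)
  also have "\<dots> \<le> \<bar>dc i a - dc j a\<bar> * dg j + dc j a * \<bar>dg j - dg i\<bar>"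
    using dgs dc_bounds(1)[of j a] by (intro order_trans[OF abs_triangle_ineq]) (simp add: abs_mult)
  also have "\<dots> \<le> (2 * \<eta>) * dg j + dg j * (2 * real K * \<eta>)"
    using dgs dc_same[OF assms] dg_same[OF assms(1-3)] dc_bounds[of j a] by (intro add_mono mult_mono) auto
  also have "\<dots> \<le> (4 * real K * \<eta>) * dg j"
  proof -
    have "1 * \<eta> \<le> real K * \<eta>" using K_pos[OF assms(1)] eta by (intro mult_right_mono) auto
    then have "2 * \<eta> + 2 * real K * \<eta> \<le> 4 * real K * \<eta>" by (simp only: mult.assoc)
    then have "(2 * \<eta> + 2 * real K * \<eta>) * dg j \<le> (4 * real K * \<eta>) * dg j"
      using dgs by (intro mult_right_mono) auto
    then show ?thesis by (simp add: algebra_simps)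
  qed
  finally have num: "\<bar>dc i a * dg j - dc j a * dg i\<bar> \<le> (4 * real K * \<eta>) * dg j" .
  have "share i a - share j a = (dc i a * dg j - dc j a * dg i) / (dg i * dg j)"
    using dgs by (simp add: share_def field_simps)
  then have "\<bar>share i a - share j a\<bar> = \<bar>dc i a * dg j - dc j a * dg i\<bar> / (dg i * dg j)"
    using dgs by (simp add: abs_divide abs_mult)
  also have "\<dots> \<le> (4 * real K * \<eta>) * dg j / (dg i * dg j)"
    using num dgs by (intro divide_right_mono) auto
  also have "\<dots> = (4 * real K * \<eta>) / dg i" using dgs by simp
  also have "\<dots> \<le> (4 * real K * \<eta>) / (\<theta> * mx / (2 * C))"
    using dg_lower[OF assms(1)] dgs eta par mn by (intro divide_left_mono) auto
  finally show ?thesis by (simp add: mult_ac)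
qed

text \<open>The difference is \<open>\<theta> - \<rho>\<close> times an average of
  \<open>share i a - share j a\<close> with weights \<open>share i a\<close>. These sum to 1, so the
  sum over communities costs no further factor \<open>K\<close>.\<close>

lemma block_mean_same:
  assumes "i < n" "j < n" "z i = z j"
  shows "\<bar>block_mean i i - block_mean i j\<bar> \<le> (\<theta> - \<rho>) * (8 * real K * C * \<eta> / (\<theta> * mx))"
proof -
  have "\<bar>\<Sum>a<K. share i a * (share i a - share j a)\<bar> \<le> (\<Sum>a<K. \<bar>share i a * (share i a - share j a)\<bar>)"
    by (rule sum_abs)
  also have "\<dots> \<le> (\<Sum>a<K. share i a * (8 * real K * C * \<eta> / (\<theta> * mx)))"
    using share_same[OF assms] share_props(1)[OF assms(1)]
    by (intro sum_mono) (simp only: abs_mult abs_of_nonneg lessThan_iff mult_left_mono)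
  also have "\<dots> = 8 * real K * C * \<eta> / (\<theta> * mx)"
    unfolding sum_distrib_right[symmetric] share_props(3)[OF assms(1)] by simp
  finally have "\<bar>\<Sum>a<K. share i a * (share i a - share j a)\<bar> \<le> 8 * real K * C * \<eta> / (\<theta> * mx)" .
  then have "(\<theta> - \<rho>) * \<bar>\<Sum>a<K. share i a * (share i a - share j a)\<bar> \<le> (\<theta> - \<rho>) * (8 * real K * C * \<eta> / (\<theta> * mx))"
    using par by (intro mult_left_mono) auto
  moreover have "block_mean i i - block_mean i j = (\<theta> - \<rho>) * (\<Sum>a<K. share i a * (share i a - share j a))"
    by (simp add: block_mean_def right_diff_distrib sum_subtractf)
  ultimately show ?thesis using par by (simp add: abs_mult)
qed

lemma block_mean_commute: "block_mean i j = block_mean j i"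
  by (simp add: block_mean_def mult.commute)

text \<open>The shares are normalised by the degrees, so a larger count in the own community could
  be offset by a larger degree. Cross-multiplying the expected counts and degrees shows that it is
  not; the premise \<open>half\<close> keeps the resulting factor
  \<open>\<rho> * (real n - csize a)\<close> of order \<open>\<rho> * mx\<close>, where
  \<open>\<theta> * csize b\<close> alone would give only order
  \<open>\<theta> * mn\<close>.\<close>

lemma share_diff:
  assumes "i < n" "j < n" "z i \<noteq> z j" and half: "csize (z i) \<le> real n / 2"
  shows "mn * (\<theta> - \<rho>) / (16 * C * (real K)\<^sup>2 * (\<theta> * mx)) \<le> share i (z i) - share j (z i)"
proof -
  define a where "a = z i"
  define b where "b = z j"
  define \<gamma> where "\<gamma> = \<theta> - \<rho>"
  define t where "t = \<theta> * mx"
  have aK: "a < K" "b < K" "a \<noteq> b" using labels assms by (auto simp: a_def b_def)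
  have g: "\<gamma> > 0" using par by (simp add: \<gamma>_def)
  have sz: "mn \<le> csize a" "csize a \<le> mx" "0 \<le> csize b" "csize b \<le> mx"
    using sizes[OF aK(1)] sizes[OF aK(2)] by (auto simp: csize_def)
  have t: "0 < t" using par mn by (simp add: t_def)
  define Da where "Da = \<rho> * real n + \<gamma> * csize a"
  define Db where "Db = \<rho> * real n + \<gamma> * csize b"
  have cl: "\<bar>dc i a - csize a * \<theta>\<bar> \<le> 2 * \<eta>" "\<bar>dc j a - csize a * \<rho>\<bar> \<le> 2 * \<eta>"
    "\<bar>dg i - Da\<bar> \<le> 2 * real K * \<eta>" "\<bar>dg j - Db\<bar> \<le> 2 * real K * \<eta>"
    using dc_close[OF assms(1) aK(1)] dc_close[OF assms(2) aK(1)] dg_close[OF assms(1)] dg_close[OF assms(2)] aK(3)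
    by (auto simp: a_def b_def link_def Da_def Db_def \<gamma>_def)
  note dgs = dg_ge_2[OF assms(1)] dg_ge_2[OF assms(2)]
  note dgu = dg_upper[OF assms(1), folded t_def] dg_upper[OF assms(2), folded t_def]
  have K1: "1 \<le> real K" using K_pos[OF assms(1)] .
  have er: "\<bar>x * d - csize a * r * D\<bar> \<le> 6 * real K * \<eta> * t"
    if "\<bar>x - csize a * r\<bar> \<le> 2 * \<eta>" "\<bar>d - D\<bar> \<le> 2 * real K * \<eta>" "0 \<le> d" "d \<le> 2 * real K * t" "0 \<le> r" "r \<le> \<theta>"
    for x d r D
  proof -
    have "csize a * r \<le> mx * \<theta>" "0 \<le> csize a * r" using sz mn that by (auto intro!: mult_mono)
    then have r: "csize a * r \<le> t" "0 \<le> csize a * r" by (simp_all add: t_def mult.commute)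
    have "\<bar>x * d - csize a * r * D\<bar> = \<bar>(x - csize a * r) * d + csize a * r * (d - D)\<bar>"
      by (simp add: algebra_simps)
    also have "\<dots> \<le> \<bar>x - csize a * r\<bar> * d + csize a * r * \<bar>d - D\<bar>"
      using that(3) r(2) abs_triangle_ineq[of "(x - csize a * r) * d" "csize a * r * (d - D)"]
      by (simp only: abs_mult[of _ d] abs_mult[of "csize a * r"] abs_of_nonneg)
    also have "\<dots> \<le> (2 * \<eta>) * (2 * real K * t) + t * (2 * real K * \<eta>)"
      using that r t eta by (intro add_mono mult_mono) auto
    finally show ?thesis by (simp add: algebra_simps)
  qed
  have e1: "\<bar>dc i a * dg j - csize a * \<theta> * Db\<bar> \<le> 6 * real K * \<eta> * t"
    using cl dgs dgu par by (intro er) auto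
  have e2: "\<bar>dc j a * dg i - csize a * \<rho> * Da\<bar> \<le> 6 * real K * \<eta> * t"
    using cl dgs dgu par by (intro er) auto
  \<comment> \<open>The exact difference of the cross-products with all fluctuations removed; both
    summands in the bracket are nonnegative.\<close>
  have "csize a * \<theta> * Db - csize a * \<rho> * Da = csize a * \<gamma> * (\<rho> * (real n - csize a) + \<theta> * csize b)"
    by (simp add: Da_def Db_def \<gamma>_def algebra_simps)
  moreover have "mn * \<gamma> * (t / (2 * C)) \<le> csize a * \<gamma> * (\<rho> * (real n - csize a) + \<theta> * csize b)"
  proof (intro mult_mono)
    have "t / C \<le> \<rho> * mx" unfolding t_def
      using par mn by (simp add: divide_le_eq) (metis mult.assoc mult.commute mult_right_mono less_imp_le order.trans)
    then have "t / (2 * C) \<le> \<rho> * (mx / 2)" by simp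
    also have "\<dots> \<le> \<rho> * (real n - csize a)" using half mx_le par by (intro mult_left_mono) (auto simp: a_def)
    also have "\<dots> \<le> \<rho> * (real n - csize a) + \<theta> * csize b" using par sz by simp
    finally show "t / (2 * C) \<le> \<rho> * (real n - csize a) + \<theta> * csize b" .
  qed (use sz g mn t par in auto)
  ultimately have ideal: "mn * \<gamma> * (t / (2 * C)) \<le> csize a * \<theta> * Db - csize a * \<rho> * Da" by simp
  \<comment> \<open>The two errors \<open>e1\<close> and \<open>e2\<close> together use up half of
    the ideal difference; this fixes the constant 48 in \<open>sep\<close>.\<close>
  have noise: "12 * real K * \<eta> * t \<le> mn * \<gamma> * (t / (4 * C))"
  proof -
    have "48 * real K * C * \<eta> * t \<le> mn * \<gamma> * t" using sep t by (intro mult_right_mono) (auto simp: \<gamma>_def)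
    then show ?thesis using par by (simp add: field_simps)
  qed
  have split: "mn * \<gamma> * (t / (2 * C)) = mn * \<gamma> * (t / (4 * C)) + mn * \<gamma> * (t / (4 * C))"
    by (simp add: field_simps)
  have num: "mn * \<gamma> * (t / (4 * C)) \<le> dc i a * dg j - dc j a * dg i"
    using e1 e2 ideal noise split by linarith
  have "dg i * dg j \<le> (2 * real K * t) * (2 * real K * t)"
    using dgs dgu t by (intro mult_mono) auto
  moreover have "0 \<le> dc i a * dg j - dc j a * dg i"
    using num mn g t par by (intro order_trans[OF _ num]) simp
  ultimately have "mn * \<gamma> * (t / (4 * C)) / ((2 * real K * t) * (2 * real K * t)) \<le> (dc i a * dg j - dc j a * dg i) / (dg i * dg j)"
    using num dgs by (intro frac_le) auto
  also have "(dc i a * dg j - dc j a * dg i) / (dg i * dg j) = share i a - share j a"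
    using dgs by (simp add: share_def field_simps)
  also have "mn * \<gamma> * (t / (4 * C)) / ((2 * real K * t) * (2 * real K * t)) = mn * \<gamma> / (16 * C * (real K)\<^sup>2 * t)"
    using t K1 par by (simp add: field_simps power2_eq_square)
  finally show ?thesis by (simp add: a_def \<gamma>_def t_def)
qed

text \<open>The combination on the right is \<open>\<theta> - \<rho>\<close> times the squared
  distance of the two share vectors, so one coordinate is enough. Two distinct communities cannot
  both have more than \<open>n / 2\<close> vertices, and \<open>share_diff\<close> is applied to the
  one that does not.\<close>

lemma block_mean_gap:
  assumes "i < n" "j < n" "z i \<noteq> z j"
  shows "(\<theta> - \<rho>) * (mn * (\<theta> - \<rho>) / (16 * C * (real K)\<^sup>2 * (\<theta> * mx)))\<^sup>2
    \<le> block_mean i i + block_mean j j - 2 * block_mean i j"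
proof -
  define v where "v = mn * (\<theta> - \<rho>) / (16 * C * (real K)\<^sup>2 * (\<theta> * mx))"
  have v: "0 \<le> v" using par mn unfolding v_def by simp
  have "csize (z i) + csize (z j) \<le> (\<Sum>a<K. csize a)"
  proof -
    have "csize (z i) + csize (z j) = sum csize {z i, z j}" using assms(3) by simp
    also have "\<dots> \<le> (\<Sum>a<K. csize a)" using labels assms by (intro sum_mono2) (auto simp: csize_def)
    finally show ?thesis .
  qed
  then consider "csize (z i) \<le> real n / 2" | "csize (z j) \<le> real n / 2" unfolding n_eq by linarith
  then obtain a where a: "a < K" "v \<le> \<bar>share i a - share j a\<bar>"
  proof cases
    case 1
    from share_diff[OF assms 1] have "v \<le> share i (z i) - share j (z i)" by (simp add: v_def)
    then show ?thesis using that[of "z i"] labels[OF assms(1)] by linarith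
  next
    case 2
    from share_diff[OF assms(2,1) assms(3)[symmetric] 2] have "v \<le> share j (z j) - share i (z j)" by (simp add: v_def)
    then show ?thesis using that[of "z j"] labels[OF assms(2)] by linarith
  qed
  have "v\<^sup>2 \<le> (share i a - share j a)\<^sup>2" using a(2) v by (simp add: abs_le_square_iff[symmetric])
  also have "\<dots> \<le> (\<Sum>a<K. (share i a - share j a)\<^sup>2)"
    using a(1) by (intro member_le_sum) auto
  also have "\<dots> = (\<Sum>a<K. share i a * share i a) + (\<Sum>a<K. share j a * share j a) - 2 * (\<Sum>a<K. share i a * share j a)"
    by (simp add: power2_eq_square algebra_simps sum.distrib sum_subtractf sum_distrib_left)
  finally have "(\<theta> - \<rho>) * v\<^sup>2 \<le> (\<theta> - \<rho>) * ((\<Sum>a<K. share i a * share i a) + (\<Sum>a<K. share j a * share j a) - 2 * (\<Sum>a<K. share i a * share j a))"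
    using par by (intro mult_left_mono) auto
  then show ?thesis by (simp add: block_mean_def v_def algebra_simps)
qed

text \<open>The threshold is the bound of \<open>T_stat_le\<close> with
  \<open>l = \<theta> / (2 * C)\<close> and \<open>u = (1 + \<kappa>) / 2\<close>: the factor 192 is
  12 * 4 * 2 * 2. Pairs \<open>i = j\<close> fall under the case of equal labels. In the other case
  the gap exceeds \<open>\<Delta>\<close> by a factor that pushes the statistic strictly above this
  threshold.\<close>

lemma AWCD1_recovers:
  assumes \<kappa>: "\<theta> < \<kappa>" "\<kappa> < 1"
    and \<Delta>: "(\<theta> - \<rho>) * (8 * real K * C * \<eta> / (\<theta> * mx)) + err \<le> \<Delta>"
    and small: "\<Delta> \<le> \<theta> / (2 * C)" "\<Delta> \<le> (1 - \<kappa>) / 2" "0 < \<Delta>"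
    and gap: "(4 + 512 * C\<^sup>2 * (real K)\<^sup>2 / (1 - \<kappa>)) * \<Delta>
      \<le> (\<theta> - \<rho>) * (mn * (\<theta> - \<rho>) / (16 * C * (real K)\<^sup>2 * (\<theta> * mx)))\<^sup>2"
    and ij: "i < n" "j < n"
  shows "AWCD1 n (adjacency g) (192 * C * (real K)\<^sup>2 * \<theta> * mx\<^sup>2 * \<Delta>\<^sup>2 / (1 - \<kappa>)) i j = same_community z i j"
proof -
  let ?Y = "adjacency g"
  define lam where "lam = 192 * C * (real K)\<^sup>2 * \<theta> * mx\<^sup>2 * \<Delta>\<^sup>2 / (1 - \<kappa>)"
  have K1: "1 \<le> real K" using K_pos[OF ij(1)] .
  have \<theta>0: "0 < \<theta>" using par by simp
  have mx0: "0 < mx" using mn by simp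
  have low: "\<theta> / (2 * C) \<le> \<rho> - \<Delta>"
  proof -
    have "\<theta> / C \<le> \<rho>" using par by (simp add: divide_le_eq mult.commute)
    then show ?thesis using small(1) by (simp add: field_simps)
  qed
  have high: "\<theta> + \<Delta> \<le> (1 + \<kappa>) / 2" using \<kappa> small by (simp add: field_simps)
  have "\<theta> / (2 * C) \<le> \<theta> / 1" using par by (intro divide_left_mono) auto
  then have twice: "\<theta> + \<Delta> \<le> 2 * \<theta>" using small by simp
  have "0 \<le> (\<theta> - \<rho>) * (8 * real K * C * \<eta> / (\<theta> * mx))" using par eta mx0 by simp
  then have err: "err \<le> \<Delta>" using \<Delta> by linarith
  show ?thesis
  proof (cases "z i = z j")
    case True
    have close: "\<bar>theta_est n ?Y i i - block_mean i j\<bar> \<le> \<Delta>"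
      "\<bar>theta_est n ?Y j j - block_mean i j\<bar> \<le> \<Delta>" "\<bar>theta_est n ?Y i j - block_mean i j\<bar> \<le> \<Delta>"
      using theta_est_close[OF ij(1) ij(1)] theta_est_close[OF ij(2) ij(2)] theta_est_close[OF ij]
        block_mean_same[OF ij True] block_mean_same[OF ij(2,1) True[symmetric]] block_mean_commute[of i j] \<Delta> err
      by linarith+
    have "T_stat n ?Y i j \<le> 12 * (4 * (real K)\<^sup>2 * (\<theta>\<^sup>2 * mx\<^sup>2)) * \<Delta>\<^sup>2 / (\<theta> / (2 * C) * (1 - (1 + \<kappa>) / 2))"
      using low high block_mean_bounds[OF ij] \<theta>0 par \<kappa>
      by (intro T_stat_le[where p="block_mean i j"] close N_count_pos N_count_bounds(2) ij) auto
    also have "\<dots> = lam"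
      using \<theta>0 par \<kappa> by (simp add: lam_def field_simps power2_eq_square)
    finally show ?thesis using True by (simp add: AWCD1_def same_community_def lam_def)
  next
    case False
    \<comment> \<open>In \<open>gap\<close> the summand 4 pays for the errors of the estimators,
      which enter with weights 1, 1 and 2. The rest \<open>R\<close> is chosen such that
      \<open>R^2 / (1024 * C^2)\<close> exceeds the factor 192 \<open>C K^2 / (1 - \<kappa>)\<close>
      of the threshold.\<close>
    define R where "R = 512 * C\<^sup>2 * (real K)\<^sup>2 / (1 - \<kappa>)"
    have R0: "0 < R" using par K1 \<kappa> by (simp add: R_def)
    have "R * \<Delta> \<le> theta_est n ?Y i i + theta_est n ?Y j j - 2 * theta_est n ?Y i j"
    proof -
      have "(4 + R) * \<Delta> \<le> block_mean i i + block_mean j j - 2 * block_mean i j"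
        using gap block_mean_gap[OF ij False] by (simp add: R_def)
      then have "4 * \<Delta> + R * \<Delta> \<le> block_mean i i + block_mean j j - 2 * block_mean i j"
        by (simp add: algebra_simps)
      then show ?thesis
        using theta_est_close[OF ij(1) ij(1)] theta_est_close[OF ij(2) ij(2)] theta_est_close[OF ij] err
        by linarith
    qed
    moreover have "{theta_est n ?Y i i, theta_est n ?Y j j, theta_est n ?Y i j} \<subseteq> {\<theta> / (2 * C)..\<theta> + \<Delta>}"
      using theta_est_close[OF ij(1) ij(1)] theta_est_close[OF ij(2) ij(2)] theta_est_close[OF ij]
        block_mean_bounds[OF ij(1) ij(1)] block_mean_bounds[OF ij(2) ij(2)] block_mean_bounds[OF ij] err low
      by (auto simp: abs_le_iff)
    ultimately have "\<theta>\<^sup>2 * mx\<^sup>2 / (8 * C\<^sup>2) * (R * \<Delta>)\<^sup>2 / (64 * (2 * \<theta>)) \<le> T_stat n ?Y i j"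
      using \<theta>0 mx0 par high \<kappa> twice R0 small(3)
      by (intro T_stat_ge[where l="\<theta> / (2 * C)" and u="\<theta> + \<Delta>"] N_count_bounds(1) ij) auto
    also have "\<theta>\<^sup>2 * mx\<^sup>2 / (8 * C\<^sup>2) * (R * \<Delta>)\<^sup>2 / (64 * (2 * \<theta>)) = \<theta> * mx\<^sup>2 * \<Delta>\<^sup>2 * (R\<^sup>2 / (1024 * C\<^sup>2))"
      using \<theta>0 par by (simp add: field_simps power2_eq_square)
    finally have T: "\<theta> * mx\<^sup>2 * \<Delta>\<^sup>2 * (R\<^sup>2 / (1024 * C\<^sup>2)) \<le> T_stat n ?Y i j" .
    have "192 * C * (real K)\<^sup>2 / (1 - \<kappa>) < R\<^sup>2 / (1024 * C\<^sup>2)"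
    proof -
      have "R\<^sup>2 / (1024 * C\<^sup>2) = 256 * (C * C * (real K)\<^sup>2 * (real K)\<^sup>2) / ((1 - \<kappa>) * (1 - \<kappa>))"
      proof -
        have "(512 * C\<^sup>2 * (real K)\<^sup>2 / e)\<^sup>2 / (1024 * C\<^sup>2) = 256 * (C * C * (real K)\<^sup>2 * (real K)\<^sup>2) / (e * e)"
          if "e > 0" for e using par that by (simp add: field_simps power2_eq_square)
        then show ?thesis using \<kappa> by (simp add: R_def)
      qed
      moreover have "256 * (C * 1 * (real K)\<^sup>2 * 1) / ((1 - \<kappa>) * 1) \<le> 256 * (C * C * (real K)\<^sup>2 * (real K)\<^sup>2) / ((1 - \<kappa>) * (1 - \<kappa>))"
        using par \<kappa> K1 \<theta>0 by (intro frac_le mult_mono) (auto simp: one_le_power)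
      moreover have "192 * C * (real K)\<^sup>2 / (1 - \<kappa>) < 256 * (C * 1 * (real K)\<^sup>2 * 1) / ((1 - \<kappa>) * 1)"
        using par \<kappa> K1 by (simp add: divide_strict_right_mono)
      ultimately show ?thesis by linarith
    qed
    then have "\<theta> * mx\<^sup>2 * \<Delta>\<^sup>2 * (192 * C * (real K)\<^sup>2 / (1 - \<kappa>)) < \<theta> * mx\<^sup>2 * \<Delta>\<^sup>2 * (R\<^sup>2 / (1024 * C\<^sup>2))"
      using \<theta>0 mx0 small(3) by (intro mult_strict_left_mono) auto
    then have "lam < T_stat n ?Y i j" using T by (simp add: lam_def mult_ac)
    then show ?thesis using False by (simp add: AWCD1_def same_community_def lam_def)
  qed
qed

end

subsection \<open>The signal-to-noise condition\<close>

lemma n_min_n_max_bounds: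
  assumes "a < K"
  shows "n_min K n z \<le> card (community n z a)" "card (community n z a) \<le> n_max K n z"
  using assms by (auto simp: n_min_def n_max_def)

lemma n_max_le: "K > 0 \<Longrightarrow> n_max K n z \<le> n"
proof -
  assume "K > 0"
  have "card (community n z a) \<le> n" for a
    using card_mono[of "{..<n}" "community n z a"] by (auto simp: community_def)
  then show ?thesis using \<open>K > 0\<close> unfolding n_max_def by (intro Max.boundedI) auto
qed

lemma n_le_K_n_max:
  assumes "z ` {..<n} \<subseteq> {..<K}"
  shows "n \<le> K * n_max K n z"
proof -
  have "{..<n} = (\<Union>a<K. community n z a)" using assms by (auto simp: community_def)
  then have "n = card (\<Union>a<K. community n z a)" by (metis card_lessThan)
  also have "\<dots> \<le> (\<Sum>a<K. card (community n z a))" by (rule card_UN_le) simp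
  also have "\<dots> \<le> (\<Sum>a<K. n_max K n z)" using n_min_n_max_bounds by (intro sum_mono) auto
  finally show ?thesis by simp
qed

text \<open>Both sets are deterministic here, so nothing is conditioned on and \<open>I\<close> is
  empty.\<close>

lemma degree_concentration:
  assumes par: "0 \<le> \<rho>" "\<rho> \<le> \<theta>" "\<theta> \<le> 1" and i: "i < n"
    and M: "real (card (community n z b)) * \<theta> \<le> M" "0 < M" and a: "0 \<le> a" "a \<le> 2 * M"
  shows "measure_pmf.prob (sbm n z \<theta> \<rho>)
    {g. \<bar>(\<Sum>l\<in>community n z b. adjacency g i l) - (\<Sum>l\<in>community n z b. edge_mean z \<theta> \<rho> i l)\<bar> \<ge> a}
    \<le> 2 * exp (- (a\<^sup>2 / (8 * M)))"
  using sbm_concentration[OF par, where A="\<lambda>_. {i}" and B="\<lambda>_. community n z b" and n=n and I="{}" and z=z and M=M and a=a]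
    M a i by (auto simp: community_def)

lemma nbhd_adjacency_cong:
  assumes "\<And>u v. u < v \<Longrightarrow> v < n \<Longrightarrow> u = i \<or> v = i \<Longrightarrow> g (u, v) = g' (u, v)" and "i < n"
  shows "nbhd n (adjacency g) i = nbhd n (adjacency g') i"
proof -
  have "adjacency g i l = adjacency g' i l" if "l < n" for l
    using assms(1)[of i l] assms(1)[of l i] assms(2) that
    by (cases "i < l") (auto simp: adjacency_def min_def max_def)
  then show ?thesis by (auto simp: nbhd_def)
qed

text \<open>There are no loops, so each neighbourhood without the other vertex avoids both
  \<open>i\<close> and \<open>j\<close>. It is determined by the edges touching
  \<open>I = {i, j}\<close>, as \<open>sbm_concentration\<close> requires.\<close>

lemma cross_concentration:
  assumes par: "0 \<le> \<rho>" "\<rho> \<le> \<theta>" "\<theta> \<le> 1" and ij: "i < n" "j < n"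
    and M: "0 < M" and a: "0 \<le> a" "a \<le> 2 * M"
  shows "measure_pmf.prob (sbm n z \<theta> \<rho>)
    {g. real (card (nbhd n (adjacency g) i - {j})) * real (card (nbhd n (adjacency g) j - {i})) * \<theta> \<le> M \<and>
      \<bar>(\<Sum>k\<in>nbhd n (adjacency g) i - {j}. \<Sum>l\<in>nbhd n (adjacency g) j - {i}. adjacency g k l)
       - (\<Sum>k\<in>nbhd n (adjacency g) i - {j}. \<Sum>l\<in>nbhd n (adjacency g) j - {i}. edge_mean z \<theta> \<rho> k l)\<bar> \<ge> a}
    \<le> 2 * exp (- (a\<^sup>2 / (8 * M)))"
proof (rule sbm_concentration[OF par _ _ _ M a, where I="{i, j}"])
  show "nbhd n (adjacency g) i - {j} \<subseteq> {..<n} - {i, j}" "nbhd n (adjacency g) j - {i} \<subseteq> {..<n} - {i, j}" for g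
    using adjacency_basic(2) by (auto simp: nbhd_def)
  fix g g' :: "nat \<times> nat \<Rightarrow> bool"
  assume "\<And>u v. u < v \<Longrightarrow> v < n \<Longrightarrow> u \<in> {i, j} \<or> v \<in> {i, j} \<Longrightarrow> g (u, v) = g' (u, v)"
  then show "nbhd n (adjacency g) i - {j} = nbhd n (adjacency g') i - {j} \<and>
      nbhd n (adjacency g) j - {i} = nbhd n (adjacency g') j - {i}"
    using nbhd_adjacency_cong[of n i g g', OF _ ij(1)] nbhd_adjacency_cong[of n j g g', OF _ ij(2)] by blast
qed

lemma prob_UN_le:
  assumes "finite I" "\<And>i. i \<in> I \<Longrightarrow> measure_pmf.prob M (B i) \<le> b"
  shows "measure_pmf.prob M (\<Union>i\<in>I. B i) \<le> real (card I) * b"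
proof -
  have "measure_pmf.prob M (\<Union>i\<in>I. B i) \<le> (\<Sum>i\<in>I. measure_pmf.prob M (B i))"
    using assms(1) by (intro measure_pmf.finite_measure_subadditive_finite) auto
  also have "\<dots> \<le> (\<Sum>i\<in>I. b)" using assms(2) by (intro sum_mono) auto
  finally show ?thesis by simp
qed

text \<open>
  The common order of magnitude of all fluctuations of the estimators: edges between two
  neighbourhoods contribute the first summand, the composition of the neighbourhoods the second one.
\<close>

definition noise :: "real \<Rightarrow> real \<Rightarrow> real" where
  "noise mn \<theta> = sqrt (ln mn * (1 / mn\<^sup>2 + \<theta>\<^sup>2 / mn) / \<theta>)"

lemma noise_nonneg: "1 \<le> mn \<Longrightarrow> 0 < \<theta> \<Longrightarrow> 0 \<le> noise mn \<theta>"
  by (auto simp: noise_def intro!: divide_nonneg_pos mult_nonneg_nonneg add_nonneg_nonneg)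

lemma noise_sq:
  assumes "1 \<le> mn" "0 < \<theta>"
  shows "(noise mn \<theta>)\<^sup>2 = ln mn / (\<theta> * mn\<^sup>2) + ln mn * \<theta> / mn"
proof -
  have "0 \<le> ln mn * (1 / mn\<^sup>2 + \<theta>\<^sup>2 / mn) / \<theta>"
    using assms by (intro divide_nonneg_pos mult_nonneg_nonneg add_nonneg_nonneg) auto
  then show ?thesis using assms by (simp add: noise_def field_simps power2_eq_square)
qed

text \<open>Sixth powers clear all fractional exponents. Up to the factor
  \<open>(mx / mn)^4\<close>, the two entries of the maximum become \<open>\<theta>^4\<close> times
  the two summands of the squared noise, so the squared claim is the sum of the two bounds.\<close>

lemma noise_hypothesis:
  fixes mn mx \<theta> \<gamma> c :: real
  assumes mn: "1 \<le> mn" "mn \<le> mx" "1 \<le> ln mn" and \<theta>: "0 < \<theta>" and \<gamma>: "0 < \<gamma>" and c: "0 < c"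
    and hyp: "(mx / mn) powr (2/3) * max (mn powr (-1/3) * \<theta> powr (1/2) * ln mn powr (1/6))
        (mn powr (-1/6) * \<theta> powr (5/6) * ln mn powr (1/6)) < c * \<gamma>"
  shows "mx\<^sup>2 * \<theta>\<^sup>2 * noise mn \<theta> \<le> (2 * c ^ 3) * (mn\<^sup>2 * \<gamma> ^ 3)"
proof -
  define L where "L = ln mn"
  have mx: "0 < mx" and L: "0 < L" using mn unfolding L_def by linarith+
  have six: "(x powr a) ^ 6 = x powr (6 * a)" if "0 < x" for x a :: real
    using that by (simp add: powr_realpow[symmetric] powr_powr mult.commute)
  have pw: "(x * y) < c * \<gamma> \<Longrightarrow> 0 \<le> x * y \<Longrightarrow> x ^ 6 * y ^ 6 \<le> c ^ 6 * \<gamma> ^ 6" for x y :: real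
    using power_mono[of "x * y" "c * \<gamma>" 6] by (simp add: power_mult_distrib)
  have r: "((mx / mn) powr (2/3)) ^ 6 = mx ^ 4 / mn ^ 4"
    using mn mx six[of "mx / mn" "2/3"] powr_realpow[of "mx / mn" 4] by (simp add: power_divide)
  have "(mx / mn) powr (2/3) * (mn powr (-1/3) * \<theta> powr (1/2) * L powr (1/6)) < c * \<gamma>"
    by (rule le_less_trans[OF _ hyp]) (auto simp: L_def intro!: mult_left_mono)
  from pw[OF this] have "mx ^ 4 / mn ^ 4 * ((mn powr (-1/3)) ^ 6 * (\<theta> powr (1/2)) ^ 6 * (L powr (1/6)) ^ 6) \<le> c ^ 6 * \<gamma> ^ 6"
    unfolding r power_mult_distrib by simp
  moreover have "(mn powr (-1/3)) ^ 6 = 1 / mn ^ 2" "(\<theta> powr (1/2)) ^ 6 = \<theta> ^ 3" "(L powr (1/6)) ^ 6 = L"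
    using six[of mn "-1/3"] six[of \<theta> "1/2"] six[of L "1/6"] mn \<theta> L
      powr_realpow[of \<theta> 3] powr_realpow[of mn 2] by (auto simp: powr_minus field_simps)
  ultimately have 1: "mx ^ 4 / mn ^ 4 * (\<theta> ^ 3 * L / mn ^ 2) \<le> c ^ 6 * \<gamma> ^ 6" by simp
  have "(mx / mn) powr (2/3) * (mn powr (-1/6) * \<theta> powr (5/6) * L powr (1/6)) < c * \<gamma>"
    by (rule le_less_trans[OF _ hyp]) (auto simp: L_def intro!: mult_left_mono)
  from pw[OF this] have "mx ^ 4 / mn ^ 4 * ((mn powr (-1/6)) ^ 6 * (\<theta> powr (5/6)) ^ 6 * (L powr (1/6)) ^ 6) \<le> c ^ 6 * \<gamma> ^ 6"
    unfolding r power_mult_distrib by simp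
  moreover have "(mn powr (-1/6)) ^ 6 = 1 / mn" "(\<theta> powr (5/6)) ^ 6 = \<theta> ^ 5" "(L powr (1/6)) ^ 6 = L"
    using six[of mn "-1/6"] six[of \<theta> "5/6"] six[of L "1/6"] mn \<theta> L
      powr_realpow[of \<theta> 5] by (auto simp: powr_minus field_simps)
  ultimately have 2: "mx ^ 4 / mn ^ 4 * (\<theta> ^ 5 * L / mn) \<le> c ^ 6 * \<gamma> ^ 6" by (simp add: mult_ac)
  have "(mx\<^sup>2 * \<theta>\<^sup>2 * noise mn \<theta>)\<^sup>2 = mx ^ 4 * \<theta> ^ 4 * (noise mn \<theta>)\<^sup>2"
    by (simp add: power_mult_distrib flip: power_mult)
  also have "\<dots> = mn ^ 4 * (mx ^ 4 / mn ^ 4 * (\<theta> ^ 3 * L / mn ^ 2) + mx ^ 4 / mn ^ 4 * (\<theta> ^ 5 * L / mn))"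
  proof -
    have "\<theta> ^ 4 * (L / (\<theta> * mn\<^sup>2) + L * \<theta> / mn) = \<theta> ^ 3 * L / mn ^ 2 + \<theta> ^ 5 * L / mn"
      using \<theta> by (simp add: distrib_left eval_nat_numeral mult_ac)
    then have "mx ^ 4 * \<theta> ^ 4 * (noise mn \<theta>)\<^sup>2 = mx ^ 4 * (\<theta> ^ 3 * L / mn ^ 2 + \<theta> ^ 5 * L / mn)"
      unfolding noise_sq[OF mn(1) \<theta>] L_def[symmetric] by (simp only: mult.assoc)
    moreover have "mn ^ 4 * (mx ^ 4 / mn ^ 4 * x + mx ^ 4 / mn ^ 4 * y) = mx ^ 4 * (x + y)" for x y
      using mn by (simp add: distrib_left)
    ultimately show ?thesis by (simp only:)
  qed
  also have "\<dots> \<le> mn ^ 4 * (c ^ 6 * \<gamma> ^ 6 + c ^ 6 * \<gamma> ^ 6)"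
    using 1 2 mn by (intro mult_left_mono add_mono) auto
  \<comment> \<open>The factor 2 is enlarged to 4 to obtain a perfect square.\<close>
  also have "\<dots> \<le> mn ^ 4 * (4 * (c ^ 6 * \<gamma> ^ 6))" using c \<gamma> mn by (intro mult_left_mono) auto
  also have "\<dots> = ((2 * c ^ 3) * (mn\<^sup>2 * \<gamma> ^ 3))\<^sup>2"
    by (simp add: power_mult_distrib flip: power_mult)
  finally show ?thesis by (rule power2_le_imp_le) (use c \<gamma> mn in auto)
qed

text \<open>\<open>signal\<close> says that the noise is at most \<open>\<epsilon>\<close> times the
  model-dependent part of the gap between block means. Everything else that the concentration
  argument needs (large degrees, comparable sizes, small degree fluctuations) is extracted from
  it.\<close>

locale recovery_regime =
  fixes mn mx \<theta> \<rho> \<epsilon> L F :: real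
  assumes mn: "1 \<le> mn" "mn \<le> mx" and par: "0 < \<rho>" "\<rho> < \<theta>" "\<theta> \<le> 1"
    and L: "L = ln mn" "1 \<le> L" "L\<^sup>2 \<le> mn" and F: "F = noise mn \<theta>"
    and \<epsilon>: "0 < \<epsilon>" "\<epsilon> \<le> 1 / 16"
    and signal: "mx\<^sup>2 * \<theta>\<^sup>2 * F \<le> \<epsilon> * (mn\<^sup>2 * (\<theta> - \<rho>) ^ 3)"
begin

lemma pos: "0 < mn" "0 < mx" "0 < \<theta>" "0 < L" "0 < \<theta> - \<rho>" "0 \<le> F"
  proof -
  show "0 < mn" "0 < mx" "0 < \<theta>" "0 < \<theta> - \<rho>" using mn par by auto
  show "0 < L" using L(2) by linarith
  show "0 \<le> F" using mn par noise_nonneg[of mn \<theta>] by (simp add: F)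
qed

lemma F_sq: "F\<^sup>2 = L / (\<theta> * mn\<^sup>2) + L * \<theta> / mn"
  using noise_sq[of mn \<theta>] mn pos by (simp add: F L(1))

lemma F_sq_ge: "L / (\<theta> * mn\<^sup>2) \<le> F\<^sup>2" "L * \<theta> / mn \<le> F\<^sup>2"
  using pos unfolding F_sq by simp_all

lemma F_le: "F \<le> \<epsilon> * \<theta>"
proof -
  have "mn\<^sup>2 * (\<theta> - \<rho>) ^ 3 \<le> mx\<^sup>2 * \<theta> ^ 3"
    using mn par by (intro mult_mono power_mono) auto
  then have "\<epsilon> * (mn\<^sup>2 * (\<theta> - \<rho>) ^ 3) \<le> \<epsilon> * (mx\<^sup>2 * \<theta> ^ 3)" using \<epsilon> by (intro mult_left_mono) auto
  then have "(mx\<^sup>2 * \<theta>\<^sup>2) * F \<le> (mx\<^sup>2 * \<theta>\<^sup>2) * (\<epsilon> * \<theta>)"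
    using signal by (simp add: power2_eq_square power3_eq_cube mult_ac)
  moreover have "0 < mx\<^sup>2 * \<theta>\<^sup>2" using pos by simp
  ultimately show ?thesis using mult_le_cancel_left_pos by blast
qed

text \<open>As the signal is at most of order \<open>\<theta>\<close>, the noise is at most
  \<open>\<epsilon> * \<theta>\<close>; each summand of its square is then read off separately. The
  results say that degrees and edge counts between two neighbourhoods are large against the
  logarithm, which keeps the deviations in the range of the Chernoff bound.\<close>

lemma L_le: "L \<le> \<epsilon>\<^sup>2 * (\<theta> * mn)" "L \<le> \<epsilon>\<^sup>2 * (\<theta> ^ 3 * mn\<^sup>2)"
proof -
  have "F\<^sup>2 \<le> (\<epsilon> * \<theta>)\<^sup>2" using F_le pos by (intro power_mono) auto
  then have F2: "F\<^sup>2 \<le> \<epsilon>\<^sup>2 * \<theta>\<^sup>2" by (simp add: power_mult_distrib)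
  have "L * \<theta> / mn \<le> \<epsilon>\<^sup>2 * \<theta>\<^sup>2" using F_sq_ge(2) F2 by linarith
  then have "L * \<theta> \<le> (\<epsilon>\<^sup>2 * (\<theta> * mn)) * \<theta>" using pos by (simp add: divide_le_eq power2_eq_square mult_ac)
  then show "L \<le> \<epsilon>\<^sup>2 * (\<theta> * mn)" using pos mult_le_cancel_right_pos by blast
  have "L / (\<theta> * mn\<^sup>2) \<le> \<epsilon>\<^sup>2 * \<theta>\<^sup>2" using F_sq_ge(1) F2 by linarith
  then show "L \<le> \<epsilon>\<^sup>2 * (\<theta> ^ 3 * mn\<^sup>2)"
    using pos by (simp add: divide_le_eq power2_eq_square power3_eq_cube mult_ac)
qed

lemma eps_sq: "\<epsilon>\<^sup>2 \<le> 1 / 256"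
  using power_mono[OF \<epsilon>(2), of 2] \<epsilon>(1) by (simp add: power_divide)

lemma L_le': "256 * L \<le> \<theta> * mx" "256 * L \<le> \<theta> ^ 3 * mx\<^sup>2"
proof -
  have "\<epsilon>\<^sup>2 * (\<theta> * mn) \<le> 1 / 256 * (\<theta> * mx)" using eps_sq mn par by (intro mult_mono) auto
  then show "256 * L \<le> \<theta> * mx" using L_le(1) by simp
  have "\<epsilon>\<^sup>2 * (\<theta> ^ 3 * mn\<^sup>2) \<le> 1 / 256 * (\<theta> ^ 3 * mx\<^sup>2)" using eps_sq mn par by (intro mult_mono power_mono) auto
  then show "256 * L \<le> \<theta> ^ 3 * mx\<^sup>2" using L_le(2) by simp
qed

lemma signal_sq: "mx ^ 4 * \<theta> ^ 4 * F\<^sup>2 \<le> \<epsilon>\<^sup>2 * (mn ^ 4 * (\<theta> - \<rho>) ^ 6)"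
proof -
  have "(mx\<^sup>2 * \<theta>\<^sup>2 * F)\<^sup>2 \<le> (\<epsilon> * (mn\<^sup>2 * (\<theta> - \<rho>) ^ 3))\<^sup>2"
    using signal pos by (intro power_mono) auto
  then show ?thesis by (simp add: power_mult_distrib flip: power_mult)
qed

text \<open>The assumption cannot hold for very unbalanced sizes, since
  \<open>\<theta> - \<rho>\<close> is at most 1. This makes the number of vertices polynomial in
  \<open>mn\<close>, so a union bound can be measured in powers of \<open>mn\<close>.\<close>

lemma mx_le: "mx \<le> mn\<^sup>2"
proof -
  have "mx ^ 4 * \<theta> ^ 4 * (L * \<theta> / mn) \<le> mx ^ 4 * \<theta> ^ 4 * F\<^sup>2"
    using F_sq_ge pos by (intro mult_left_mono) auto
  also note signal_sq
  also have "\<epsilon>\<^sup>2 * (mn ^ 4 * (\<theta> - \<rho>) ^ 6) \<le> 1 * (mn ^ 4 * \<theta> ^ 6)"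
    using eps_sq pos par by (intro mult_mono power_mono) auto
  finally have "(mx ^ 4 * L) * \<theta> ^ 5 \<le> (mn ^ 5 * \<theta>) * \<theta> ^ 5"
    using pos by (simp add: divide_le_eq mult_ac eval_nat_numeral)
  then have "mx ^ 4 * L \<le> mn ^ 5 * \<theta>" using pos mult_le_cancel_right_pos zero_less_power by blast
  moreover have "mx ^ 4 * 1 \<le> mx ^ 4 * L" using pos L by (intro mult_left_mono) auto
  moreover have "mn ^ 5 * \<theta> \<le> mn ^ 8 * 1" using mn par by (intro mult_mono power_increasing) auto
  ultimately have "mx ^ 4 \<le> (mn\<^sup>2) ^ 4" by (simp flip: power_mult)
  then show ?thesis using pos by (subst (asm) power_mono_iff) auto
qed

text \<open>Serves the premise \<open>sep\<close> of \<open>typical_sample\<close>. Comparing sixth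
  powers leaves a surplus factor \<open>L^2\<close>, which \<open>L^2 \<le> mn \<le> mx\<close>
  converts into the missing power of \<open>mx\<close>.\<close>

lemma separation:
  assumes "0 \<le> A" "A ^ 3 * \<epsilon> \<le> 1"
  shows "A * sqrt (mx * \<theta> * L) \<le> mn * (\<theta> - \<rho>)"
proof -
  define \<gamma> where "\<gamma> = \<theta> - \<rho>"
  have g: "0 < \<gamma>" using pos by (simp add: \<gamma>_def)
  have "mx ^ 4 * \<theta> ^ 4 * (L / (\<theta> * mn\<^sup>2)) \<le> mx ^ 4 * \<theta> ^ 4 * F\<^sup>2"
    using F_sq_ge pos by (intro mult_left_mono) auto
  also note signal_sq
  finally have s: "mx ^ 4 * \<theta> ^ 3 * L \<le> \<epsilon>\<^sup>2 * (mn ^ 6 * \<gamma> ^ 6)"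
    using pos by (simp add: divide_le_eq mult_ac eval_nat_numeral \<gamma>_def)
  have "(A\<^sup>2 * (mx * \<theta> * L)) ^ 3 = A ^ 6 * (mx ^ 3 * \<theta> ^ 3 * L * L\<^sup>2)"
    by (simp add: power_mult_distrib power2_eq_square power3_eq_cube flip: power_mult)
      (simp add: eval_nat_numeral)
  also have "\<dots> \<le> A ^ 6 * (mx ^ 3 * \<theta> ^ 3 * L * mx)"
    using pos L mn assms by (intro mult_left_mono) auto
  also have "\<dots> = A ^ 6 * (mx ^ 4 * \<theta> ^ 3 * L)" by (simp add: eval_nat_numeral)
  also have "\<dots> \<le> A ^ 6 * (\<epsilon>\<^sup>2 * (mn ^ 6 * \<gamma> ^ 6))" using s assms by (intro mult_left_mono) auto
  also have "\<dots> = (A ^ 3 * \<epsilon>)\<^sup>2 * (mn\<^sup>2 * \<gamma>\<^sup>2) ^ 3" by (simp add: power_mult_distrib flip: power_mult)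
  also have "\<dots> \<le> 1\<^sup>2 * (mn\<^sup>2 * \<gamma>\<^sup>2) ^ 3"
    using assms \<epsilon> by (intro mult_right_mono power_mono) auto
  finally have "(A\<^sup>2 * (mx * \<theta> * L)) ^ 3 \<le> (mn\<^sup>2 * \<gamma>\<^sup>2) ^ 3" by simp
  then have "A\<^sup>2 * (mx * \<theta> * L) \<le> mn\<^sup>2 * \<gamma>\<^sup>2" using pos by (subst (asm) power_mono_iff) auto
  then have "(A * sqrt (mx * \<theta> * L))\<^sup>2 \<le> (mn * \<gamma>)\<^sup>2" using pos by (simp add: power_mult_distrib)
  then show ?thesis unfolding \<gamma>_def[symmetric] by (rule power2_le_imp_le) (use pos g in auto)
qed

text \<open>The three sources of error, up to constants: fluctuation of the edge counts, bias of
  \<open>S_count\<close>, and composition of the neighbourhoods.\<close>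

lemma noise_terms:
  "sqrt (\<theta> * L) / (\<theta> * mx) \<le> F" "1 / mx \<le> F" "sqrt (mx * \<theta> * L) / mx \<le> F"
proof -
  have sq: "mn\<^sup>2 \<le> mx\<^sup>2" using mn by (intro power_mono) auto
  have a: "L / (\<theta> * mx\<^sup>2) \<le> F\<^sup>2"
  proof (rule order_trans[OF _ F_sq_ge(1)])
    show "L / (\<theta> * mx\<^sup>2) \<le> L / (\<theta> * mn\<^sup>2)" using sq pos by (intro divide_left_mono mult_left_mono) auto
  qed
  have "(sqrt (\<theta> * L) / (\<theta> * mx))\<^sup>2 = L / (\<theta> * mx\<^sup>2)"
    using pos by (simp add: power_divide power_mult_distrib) (simp add: power2_eq_square)
  with a have "(sqrt (\<theta> * L) / (\<theta> * mx))\<^sup>2 \<le> F\<^sup>2" by simp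
  then show "sqrt (\<theta> * L) / (\<theta> * mx) \<le> F" by (rule power2_le_imp_le) (use pos in auto)
  have "(1 / mx)\<^sup>2 \<le> L / (\<theta> * mx\<^sup>2)"
  proof -
    have "\<theta> * 1 \<le> 1 * L" using par L by (intro mult_mono) auto
    then show ?thesis using pos by (simp add: power_divide divide_simps)
  qed
  with a have "(1 / mx)\<^sup>2 \<le> F\<^sup>2" by linarith
  then show "1 / mx \<le> F" by (rule power2_le_imp_le) (use pos in auto)
  have "(sqrt (mx * \<theta> * L) / mx)\<^sup>2 = L * \<theta> / mx"
    using pos by (simp add: power_divide) (simp add: power2_eq_square)
  also have "\<dots> \<le> L * \<theta> / mn" using mn pos by (intro divide_left_mono) auto
  also note F_sq_ge(2)
  finally show "sqrt (mx * \<theta> * L) / mx \<le> F" by (rule power2_le_imp_le) (use pos in auto)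
qed

end

text \<open>
  The constants add up to \<open>240 = 8 * (16 + 6) + 64\<close>: estimation error given the neighbourhoods plus
  composition error, both in units of \<open>noise\<close>.
\<close>

lemma sbm_recovery_probability:
  fixes K n :: nat and z :: "nat \<Rightarrow> nat" and \<theta> \<rho> \<kappa> C \<epsilon> :: real
  defines "mn \<equiv> real (n_min K n z)" and "mx \<equiv> real (n_max K n z)"
  defines "\<Delta> \<equiv> 240 * C\<^sup>2 * real K * noise mn \<theta>"
  assumes K: "0 < K" "real K \<le> mn" and z: "z ` {..<n} = {..<K}"
    and params: "0 < \<rho>" "\<rho> < \<theta>" "\<theta> \<le> C * \<rho>" "1 \<le> C" and \<kappa>: "\<theta> < \<kappa>" "\<kappa> < 1"
    and large: "1 \<le> ln mn" "(ln mn)\<^sup>2 \<le> mn"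
    and tiny: "0 < \<epsilon>" "(384 * real K * C) ^ 3 * \<epsilon> \<le> 1"
      "240 * C\<^sup>2 * real K * \<epsilon> \<le> 1 / (2 * C)" "240 * C\<^sup>2 * real K * \<epsilon> \<le> (1 - \<kappa>) / 2"
      "(4 + 512 * C\<^sup>2 * (real K)\<^sup>2 / (1 - \<kappa>)) * (240 * C\<^sup>2 * real K) * (256 * C\<^sup>2 * (real K) ^ 4) * \<epsilon> \<le> 1"
    and signal: "mx\<^sup>2 * \<theta>\<^sup>2 * noise mn \<theta> \<le> \<epsilon> * (mn\<^sup>2 * (\<theta> - \<rho>) ^ 3)"
  shows "1 - 4 / mn\<^sup>2 \<le> measure_pmf.prob (sbm n z \<theta> \<rho>)
    {g. \<forall>i<n. \<forall>j<n. AWCD1 n (adjacency g) (192 * C * (real K)\<^sup>2 * \<theta> * mx\<^sup>2 * \<Delta>\<^sup>2 / (1 - \<kappa>)) i j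
       = same_community z i j}"
proof -
  define L where "L = ln mn"
  define F where "F = noise mn \<theta>"
  define t where "t = 192 * C * (real K)\<^sup>2 * \<theta> * mx\<^sup>2 * \<Delta>\<^sup>2 / (1 - \<kappa>)"
  have K1: "1 \<le> real K" using K(1) by simp
  have KC: "1 \<le> real K * C" using mult_mono[of 1 "real K" 1 C] K1 params by simp
  have mn1: "1 \<le> mn" using K1 K(2) by simp
  have mnmx: "mn \<le> mx"
    using n_min_n_max_bounds[OF K(1), of n z] unfolding mn_def mx_def by linarith
  have eps16: "\<epsilon> \<le> 1 / 16"
  proof -
    have "384 ^ 3 \<le> (384 * real K * C) ^ 3" using KC by (intro power_mono) auto
    then have "16 * \<epsilon> \<le> (384 * real K * C) ^ 3 * \<epsilon>" using tiny(1) by (intro mult_right_mono) auto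
    then show ?thesis using tiny(2) by linarith
  qed
  interpret recovery_regime mn mx \<theta> \<rho> \<epsilon> L F
    using mn1 mnmx params \<kappa> large tiny(1) eps16 signal by unfold_locales (auto simp: L_def F_def)
  \<comment> \<open>The factor 8 makes \<open>\<eta>^2 / (8 * (mx * \<theta>)) = 8 * L\<close>, and
    \<open>\<zeta>\<close> is scaled in the same way against \<open>M\<close>. Every bad event then
    has probability at most \<open>2 / mn^8\<close>, while there are at most \<open>2 * mn^6\<close>
    of them, because \<open>n\<close> and \<open>K\<close> are at most \<open>mn^3\<close>.\<close>
  define \<eta> where "\<eta> = 8 * sqrt (mx * \<theta> * L)"
  define \<zeta> where "\<zeta> = 16 * real K * (\<theta> * mx) * sqrt (\<theta> * L)"
  define M where "M = (2 * real K * (\<theta> * mx))\<^sup>2 * \<theta>"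
  have F0: "0 < F"
  proof -
    have "0 < 1 / mx" using pos by simp
    then show ?thesis using noise_terms(2) by linarith
  qed
  have nKmx: "real n \<le> real K * mx"
    using n_le_K_n_max[of z n K] z unfolding mx_def of_nat_mult[symmetric] by (simp del: of_nat_mult)
  define bad1 where "bad1 = (\<lambda>(i, a). {g. \<eta> \<le> \<bar>(\<Sum>l\<in>community n z a. adjacency g i l)
      - (\<Sum>l\<in>community n z a. edge_mean z \<theta> \<rho> i l)\<bar>})"
  define bad2 where "bad2 = (\<lambda>(i, j). {g.
      real (card (nbhd n (adjacency g) i - {j})) * real (card (nbhd n (adjacency g) j - {i})) * \<theta> \<le> M \<and>
      \<zeta> \<le> \<bar>(\<Sum>k\<in>nbhd n (adjacency g) i - {j}. \<Sum>l\<in>nbhd n (adjacency g) j - {i}. adjacency g k l)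
       - (\<Sum>k\<in>nbhd n (adjacency g) i - {j}. \<Sum>l\<in>nbhd n (adjacency g) j - {i}. edge_mean z \<theta> \<rho> k l)\<bar>})"
  define P where "P = sbm n z \<theta> \<rho>"
  have expL: "exp (- (8 * L)) = 1 / mn ^ 8"
  proof -
    have "exp (8 * L) = exp L ^ 8" by (simp add: exp_of_nat_mult[of 8 L, simplified])
    also have "exp L = mn" using pos by (simp add: L_def)
    finally show ?thesis by (simp add: exp_minus inverse_eq_divide)
  qed
  have b1: "measure_pmf.prob P (bad1 e) \<le> 2 / mn ^ 8" if "e \<in> {..<n} \<times> {..<K}" for e
  proof -
    obtain i a where e: "e = (i, a)" "i < n" "a < K" using \<open>e \<in> _\<close> by auto
    have "measure_pmf.prob P (bad1 e) \<le> 2 * exp (- (\<eta>\<^sup>2 / (8 * (mx * \<theta>))))"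
      unfolding bad1_def e P_def prod.case
    proof (rule degree_concentration)
      show "real (card (community n z a)) * \<theta> \<le> mx * \<theta>"
        using n_min_n_max_bounds(2)[OF e(3), of n z] pos unfolding mx_def by (intro mult_right_mono) auto
      have "\<eta>\<^sup>2 \<le> (2 * (mx * \<theta>))\<^sup>2"
      proof -
        have "64 * (mx * \<theta>) * L \<le> 64 * (mx * \<theta>) * (\<theta> * mx / 256)" using L_le'(1) pos by (intro mult_left_mono) auto
        also have "\<dots> \<le> 4 * (mx * \<theta>)\<^sup>2" using pos by (simp add: power2_eq_square)
        finally show ?thesis using pos by (simp add: \<eta>_def power_mult_distrib)
      qed
      then show "\<eta> \<le> 2 * (mx * \<theta>)" by (rule power2_le_imp_le) (use pos in auto)
    qed (use params \<kappa> pos e in \<open>auto simp: \<eta>_def\<close>)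
    also have "\<eta>\<^sup>2 / (8 * (mx * \<theta>)) = 8 * L" using pos by (simp add: \<eta>_def power_mult_distrib)
    finally show ?thesis by (simp add: expL)
  qed
  have M0: "0 < M" using pos K1 by (simp add: M_def)
  have zM: "\<zeta>\<^sup>2 = 64 * M * L"
    using pos by (simp add: \<zeta>_def M_def power_mult_distrib)
  have zM2: "\<zeta> \<le> 2 * M"
  proof -
    have "16 * L \<le> 4 * 1 * (\<theta> ^ 3 * mx\<^sup>2)" using L_le'(2) pos by simp
    also have "\<dots> \<le> 4 * (real K)\<^sup>2 * (\<theta> ^ 3 * mx\<^sup>2)" using K1 pos by (intro mult_right_mono mult_left_mono) auto
    also have "\<dots> = M" by (simp add: M_def power_mult_distrib power2_eq_square power3_eq_cube)
    finally have "4 * M * (16 * L) \<le> 4 * M * M" using M0 by (intro mult_left_mono) auto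
    then have "\<zeta>\<^sup>2 \<le> (2 * M)\<^sup>2" unfolding zM by (simp add: power2_eq_square mult_ac)
    then show ?thesis by (rule power2_le_imp_le) (use M0 in auto)
  qed
  have \<zeta>0: "0 \<le> \<zeta>" using pos by (simp add: \<zeta>_def)
  have b2: "measure_pmf.prob P (bad2 e) \<le> 2 / mn ^ 8" if "e \<in> {..<n} \<times> {..<n}" for e
  proof -
    obtain i j where e: "e = (i, j)" "i < n" "j < n" using \<open>e \<in> _\<close> by auto
    have "measure_pmf.prob P (bad2 e) \<le> 2 * exp (- (\<zeta>\<^sup>2 / (8 * M)))"
      unfolding bad2_def e P_def prod.case
      by (rule cross_concentration) (use params \<kappa> e M0 \<zeta>0 zM2 in auto)
    also have "\<zeta>\<^sup>2 / (8 * M) = 8 * L" using M0 by (simp add: zM)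
    finally show ?thesis by (simp add: expL)
  qed
  define bad where "bad = (\<Union>e\<in>{..<n} \<times> {..<K}. bad1 e) \<union> (\<Union>e\<in>{..<n} \<times> {..<n}. bad2 e)"
  have small_bad: "measure_pmf.prob P bad \<le> 4 / mn\<^sup>2"
  proof -
    have nmn: "real n \<le> mn ^ 3"
    proof -
      have "real K * mx \<le> mn * mn\<^sup>2" using K(2) mx_le pos by (intro mult_mono) auto
      then show ?thesis using nKmx by (simp add: power2_eq_square power3_eq_cube)
    qed
    have Kmn: "real K \<le> mn ^ 3" using K(2) mn1 self_le_power[of mn 3] by linarith
    have "measure_pmf.prob P bad \<le> measure_pmf.prob P (\<Union>e\<in>{..<n} \<times> {..<K}. bad1 e)
        + measure_pmf.prob P (\<Union>e\<in>{..<n} \<times> {..<n}. bad2 e)"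
      unfolding bad_def by (rule measure_Un_le) auto
    also have "\<dots> \<le> real (card ({..<n} \<times> {..<K})) * (2 / mn ^ 8) + real (card ({..<n} \<times> {..<n})) * (2 / mn ^ 8)"
      using b1 b2 by (intro add_mono prob_UN_le) auto
    also have "\<dots> = (real n * real K + real n * real n) * (2 / mn ^ 8)"
      by (simp add: card_cartesian_product algebra_simps add_divide_distrib)
    also have "\<dots> \<le> (mn ^ 3 * mn ^ 3 + mn ^ 3 * mn ^ 3) * (2 / mn ^ 8)"
      using nmn Kmn pos by (intro mult_right_mono add_mono mult_mono) auto
    also have "\<dots> = 4 / mn\<^sup>2" using pos by (simp add: field_simps eval_nat_numeral)
    finally show ?thesis .
  qed
  have good: "\<forall>i<n. \<forall>j<n. AWCD1 n (adjacency g) t i j = same_community z i j" if g: "g \<notin> bad" for g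
  proof -
    interpret ts: typical_sample n K z \<theta> \<rho> C mn mx \<eta> \<zeta> g
    proof unfold_locales
      show "z i < K" if "i < n" for i using z that by blast
      show "mn \<le> real (card (community n z a)) \<and> real (card (community n z a)) \<le> mx" if "a < K" for a
        using n_min_n_max_bounds[OF that, of n z] by (simp add: mn_def mx_def)
      show "mx \<le> real n" using n_max_le[OF K(1), of n z] by (simp add: mx_def)
      show "\<bar>(\<Sum>l\<in>community n z a. adjacency g i l) - (\<Sum>l\<in>community n z a. edge_mean z \<theta> \<rho> i l)\<bar> \<le> \<eta>"
        if "i < n" "a < K" for i a
        using g that by (force simp: bad_def bad1_def)
      show "\<bar>(\<Sum>k\<in>nbhd n (adjacency g) i - {j}. \<Sum>l\<in>nbhd n (adjacency g) j - {i}. adjacency g k l)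
       - (\<Sum>k\<in>nbhd n (adjacency g) i - {j}. \<Sum>l\<in>nbhd n (adjacency g) j - {i}. edge_mean z \<theta> \<rho> k l)\<bar> \<le> \<zeta>"
        if "i < n" "j < n" "real (card (nbhd n (adjacency g) i - {j})) * real (card (nbhd n (adjacency g) j - {i})) * \<theta>
        \<le> (2 * real K * (\<theta> * mx))\<^sup>2 * \<theta>" for i j
        using g that by (force simp: bad_def bad2_def M_def)
      have "1 \<le> mx * \<theta> * L" using L_le'(1) L(2) mult_mono[of 1 "\<theta> * mx" 1 L] by (simp add: mult_ac)
      then show "1 \<le> \<eta>" using real_sqrt_ge_one[of "mx * \<theta> * L"] unfolding \<eta>_def by linarith
      show "48 * real K * C * \<eta> \<le> mn * (\<theta> - \<rho>)"
      proof -
        have "384 * real K * C * sqrt (mx * \<theta> * L) \<le> mn * (\<theta> - \<rho>)"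
          using params by (intro separation tiny(2)) simp
        then show ?thesis by (simp add: \<eta>_def mult_ac)
      qed
    qed (use params \<kappa> pos mnmx in auto)
    have "ts.err \<le> 176 * C\<^sup>2 * real K * F"
    proof -
      have "ts.err = 8 * C\<^sup>2 * (16 * real K * (sqrt (\<theta> * L) / (\<theta> * mx)) + 6 * real K * (1 / mx))"
        unfolding ts.err_def unfolding \<zeta>_def using pos by (simp add: field_simps power2_eq_square)
      also have "\<dots> \<le> 8 * C\<^sup>2 * (16 * real K * F + 6 * real K * F)"
        using noise_terms by (intro mult_left_mono add_mono) auto
      finally show ?thesis by (simp add: algebra_simps)
    qed
    moreover have "(\<theta> - \<rho>) * (8 * real K * C * \<eta> / (\<theta> * mx)) \<le> 64 * C\<^sup>2 * real K * F"
    proof -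
      \<comment> \<open>Bounding \<open>\<theta> - \<rho>\<close> by \<open>\<theta>\<close> brings
        the composition error into the form of the second summand of \<open>noise\<close>.\<close>
      have "(\<theta> - \<rho>) * (8 * real K * C * \<eta> / (\<theta> * mx)) \<le> \<theta> * (8 * real K * C * \<eta> / (\<theta> * mx))"
        using params pos by (intro mult_right_mono) (auto simp: \<eta>_def)
      also have "\<dots> = 64 * real K * C * (sqrt (mx * \<theta> * L) / mx)"
        using pos by (simp add: \<eta>_def field_simps)
      also have "\<dots> \<le> 64 * real K * C * F" using noise_terms(3) params by (intro mult_left_mono) auto
      also have "\<dots> \<le> 64 * real K * C\<^sup>2 * F"
        using params pos self_le_power[of C 2] by (intro mult_left_mono mult_right_mono) auto
      finally show ?thesis by (simp add: mult_ac)
    qed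
    ultimately have D: "(\<theta> - \<rho>) * (8 * real K * C * \<eta> / (\<theta> * mx)) + ts.err \<le> \<Delta>"
      by (simp add: \<Delta>_def F_def[symmetric])
    have B: "0 < 240 * C\<^sup>2 * real K" using params K1 by simp
    have De: "\<Delta> \<le> (240 * C\<^sup>2 * real K * \<epsilon>) * \<theta>"
      using mult_left_mono[OF F_le, of "240 * C\<^sup>2 * real K"] B by (simp add: \<Delta>_def F_def[symmetric] mult_ac)
    have D1: "\<Delta> \<le> \<theta> / (2 * C)"
      using De mult_right_mono[OF tiny(3), of \<theta>] pos by simp
    have D2: "\<Delta> \<le> (1 - \<kappa>) / 2"
    proof -
      have "(240 * C\<^sup>2 * real K * \<epsilon>) * \<theta> \<le> ((1 - \<kappa>) / 2) * 1"
        using tiny(1,4) params \<kappa> pos by (intro mult_mono) auto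
      then show ?thesis using De by simp
    qed
    have D3: "0 < \<Delta>" using B F0 by (simp add: \<Delta>_def F_def[symmetric])
    define R where "R = 4 + 512 * C\<^sup>2 * (real K)\<^sup>2 / (1 - \<kappa>)"
    have R0: "0 < R" using \<kappa> unfolding R_def by (intro add_pos_nonneg) auto
    have gap: "R * \<Delta> \<le> (\<theta> - \<rho>) * (mn * (\<theta> - \<rho>) / (16 * C * (real K)\<^sup>2 * (\<theta> * mx)))\<^sup>2"
    proof -
      \<comment> \<open>The required gap equals \<open>X / Q\<close>, where \<open>X\<close> depends
        on the model and \<open>Q\<close> only on \<open>C\<close> and \<open>K\<close>;
        \<open>signal\<close> reads \<open>F \<le> \<epsilon> * X\<close>.\<close>
      define X where "X = mn\<^sup>2 * (\<theta> - \<rho>) ^ 3 / (mx\<^sup>2 * \<theta>\<^sup>2)"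
      have X: "0 < X" using pos by (simp add: X_def)
      have "F \<le> \<epsilon> * X"
        using ts.par signal pos by (simp add: X_def le_divide_eq F_def mult_ac)
      define Q where "Q = 256 * C\<^sup>2 * (real K) ^ 4"
      have Q: "0 < Q" using params K1 by (simp add: Q_def)
      have "R * \<Delta> = R * (240 * C\<^sup>2 * real K) * F" by (simp add: \<Delta>_def F_def)
      also have "\<dots> \<le> R * (240 * C\<^sup>2 * real K) * (\<epsilon> * X)"
        using \<open>F \<le> \<epsilon> * X\<close> R0 B by (intro mult_left_mono) auto
      also have "\<dots> = (R * (240 * C\<^sup>2 * real K) * Q * \<epsilon>) * (X / Q)" using Q by simp
      also have "\<dots> \<le> 1 * (X / Q)"
        using tiny(5) X Q by (intro mult_right_mono) (auto simp: R_def Q_def)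
      also have "1 * (X / Q) = (\<theta> - \<rho>) * (mn * (\<theta> - \<rho>) / (16 * C * (real K)\<^sup>2 * (\<theta> * mx)))\<^sup>2"
        using pos K1 params
        by (simp add: X_def Q_def power_divide power_mult_distrib power2_eq_square power3_eq_cube eval_nat_numeral mult_ac)
      finally show ?thesis .
    qed
    show ?thesis
      unfolding t_def using ts.AWCD1_recovers[OF \<kappa> D D1 D2 D3 gap[unfolded R_def]] by blast
  qed
  have "1 - measure_pmf.prob P bad = measure_pmf.prob P (UNIV - bad)"
    using measure_pmf.prob_compl[of bad P] by simp
  also have "\<dots> \<le> measure_pmf.prob P {g. \<forall>i<n. \<forall>j<n. AWCD1 n (adjacency g) t i j = same_community z i j}"
    using good by (intro measure_pmf.finite_measure_mono) auto
  finally show ?thesis using small_bad by (simp add: P_def t_def)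
qed

theorem proposition1:
  fixes K :: nat and C \<kappa> :: real
  assumes "K \<ge> 2" and "C > 1" and "0 < \<kappa>" and "\<kappa> < 1"
  shows "\<exists>c::real. c > 0 \<and>
    (\<forall>(n :: nat \<Rightarrow> nat) (z :: nat \<Rightarrow> nat \<Rightarrow> nat) (\<theta> :: nat \<Rightarrow> real) (\<rho> :: nat \<Rightarrow> real).
       (\<forall>m. z m ` {..<n m} = {..<K}) \<longrightarrow>
       (\<forall>m. \<theta> m > \<rho> m \<and> \<rho> m > 0) \<longrightarrow>
       filterlim (\<lambda>m. n_min K (n m) (z m)) at_top sequentially \<longrightarrow>
       (\<forall>m. \<theta> m / \<rho> m \<le> C) \<longrightarrow>
       (\<forall>m. \<theta> m < \<kappa>) \<longrightarrow>
       (\<forall>m. c * (\<theta> m - \<rho> m) >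
          (real (n_max K (n m) (z m)) / real (n_min K (n m) (z m))) powr (2/3) *
          max (real (n_min K (n m) (z m)) powr (-1/3) * \<theta> m powr (1/2) *
                 ln (real (n_min K (n m) (z m))) powr (1/6))
              (real (n_min K (n m) (z m)) powr (-1/6) * \<theta> m powr (5/6) *
                 ln (real (n_min K (n m) (z m))) powr (1/6))) \<longrightarrow>
       (\<exists>t :: nat \<Rightarrow> real.
          (\<lambda>m. measure_pmf.prob (sbm (n m) (z m) (\<theta> m) (\<rho> m))
             {g. \<forall>i<n m. \<forall>j<n m.
                AWCD1 (n m) (adjacency g) (t m) i j = same_community (z m) i j})
          \<longlonglongrightarrow> 1))"
proof -
  have K0: "0 < K" and K1: "1 \<le> real K" using assms(1) by auto
  \<comment> \<open>Each of the four numbers is the reciprocal of an upper bound imposed on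
    \<open>\<epsilon>\<close>; the reciprocal of their sum meets all four. They depend only on
    \<open>K\<close>, \<open>C\<close> and \<open>\<kappa>\<close>, hence so does
    \<open>c\<close>.\<close>
  define x1 where "x1 = (384 * real K * C) ^ 3"
  define x2 where "x2 = 240 * C\<^sup>2 * real K * (2 * C)"
  define x3 where "x3 = 240 * C\<^sup>2 * real K * (2 / (1 - \<kappa>))"
  define x4 where "x4 = (4 + 512 * C\<^sup>2 * (real K)\<^sup>2 / (1 - \<kappa>)) * (240 * C\<^sup>2 * real K) * (256 * C\<^sup>2 * (real K) ^ 4)"
  have x: "0 < x1" "0 < x2" "0 < x3" "0 < x4"
    using assms K0 by (auto simp: x1_def x2_def x3_def x4_def intro!: mult_pos_pos add_pos_nonneg)
  define \<epsilon> where "\<epsilon> = 1 / (x1 + x2 + x3 + x4)"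
  have \<epsilon>0: "0 < \<epsilon>" using x by (simp add: \<epsilon>_def)
  have \<epsilon>: "x1 * \<epsilon> \<le> 1" "x2 * \<epsilon> \<le> 1" "x3 * \<epsilon> \<le> 1" "x4 * \<epsilon> \<le> 1"
    using x by (simp_all add: \<epsilon>_def divide_le_eq)
  have \<epsilon>3: "240 * C\<^sup>2 * real K * \<epsilon> \<le> 1 / (2 * C)"
    using \<epsilon>(2) assms by (simp add: x2_def le_divide_eq mult_ac)
  have \<epsilon>4: "240 * C\<^sup>2 * real K * \<epsilon> \<le> (1 - \<kappa>) / 2"
    using \<epsilon>(3) assms by (simp add: x3_def divide_le_eq mult_ac)
  \<comment> \<open>With \<open>c \<le> 1\<close> the cube is at most \<open>c\<close>, and
    \<open>2 * c \<le> \<epsilon>\<close>, so the constant \<open>2 * c^3\<close> of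
    \<open>noise_hypothesis\<close> is within \<open>\<epsilon>\<close>.\<close>
  define c where "c = min 1 \<epsilon> / 2"
  have c: "0 < c" "c \<le> 1 / 2" "2 * c \<le> \<epsilon>" using \<epsilon>0 by (auto simp: c_def)
  have c3: "2 * c ^ 3 \<le> \<epsilon>"
  proof -
    have "c ^ 3 \<le> c ^ 1" using c by (intro power_decreasing) auto
    then show ?thesis using c by simp
  qed
  show ?thesis
  proof (intro exI[of _ c] conjI allI impI c(1))
    fix n :: "nat \<Rightarrow> nat" and z :: "nat \<Rightarrow> nat \<Rightarrow> nat" and \<theta> \<rho> :: "nat \<Rightarrow> real"
    assume z: "\<forall>m. z m ` {..<n m} = {..<K}"
      and pos: "\<forall>m. \<theta> m > \<rho> m \<and> \<rho> m > 0"
      and lim: "filterlim (\<lambda>m. n_min K (n m) (z m)) at_top sequentially"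
      and ratio: "\<forall>m. \<theta> m / \<rho> m \<le> C" and \<kappa>: "\<forall>m. \<theta> m < \<kappa>"
      and hyp: "\<forall>m. c * (\<theta> m - \<rho> m) >
          (real (n_max K (n m) (z m)) / real (n_min K (n m) (z m))) powr (2/3) *
          max (real (n_min K (n m) (z m)) powr (-1/3) * \<theta> m powr (1/2) *
                 ln (real (n_min K (n m) (z m))) powr (1/6))
              (real (n_min K (n m) (z m)) powr (-1/6) * \<theta> m powr (5/6) *
                 ln (real (n_min K (n m) (z m))) powr (1/6))"
    define mn where "mn = (\<lambda>m. real (n_min K (n m) (z m)))"
    define mx where "mx = (\<lambda>m. real (n_max K (n m) (z m)))"
    define t where "t = (\<lambda>m. 192 * C * (real K)\<^sup>2 * \<theta> m * (mx m)\<^sup>2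
      * (240 * C\<^sup>2 * real K * noise (mn m) (\<theta> m))\<^sup>2 / (1 - \<kappa>))"
    define Q where "Q = (\<lambda>m. measure_pmf.prob (sbm (n m) (z m) (\<theta> m) (\<rho> m))
             {g. \<forall>i<n m. \<forall>j<n m. AWCD1 (n m) (adjacency g) (t m) i j = same_community (z m) i j})"
    have mn: "filterlim mn at_top sequentially"
      unfolding mn_def using filterlim_compose[OF filterlim_real_sequentially lim] .
    \<comment> \<open>These conditions concern only \<open>n_min\<close>, so its divergence provides
      them for all but finitely many indices.\<close>
    have "eventually (\<lambda>x::real. 1 \<le> ln x \<and> (ln x)\<^sup>2 \<le> x \<and> real K \<le> x) at_top"
      by (intro eventually_conj eventually_ge_at_top; real_asymp)
    from eventually_compose_filterlim[OF this mn]
    have large: "eventually (\<lambda>m. 1 \<le> ln (mn m) \<and> (ln (mn m))\<^sup>2 \<le> mn m \<and> real K \<le> mn m) sequentially" .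
    have "eventually (\<lambda>m. 1 - 4 / (mn m)\<^sup>2 \<le> Q m) sequentially"
      using large
    proof eventually_elim
      case (elim m)
      have p: "0 < \<rho> m" "\<rho> m < \<theta> m" "0 < \<theta> m" "\<theta> m \<le> C * \<rho> m" "\<theta> m < \<kappa>"
      proof -
        show 1: "0 < \<rho> m" "\<rho> m < \<theta> m" "\<theta> m < \<kappa>" using pos \<kappa> by auto
        show "0 < \<theta> m" using 1 by linarith
        have "\<theta> m / \<rho> m \<le> C" using ratio by blast
        then show "\<theta> m \<le> C * \<rho> m" using 1(1) by (simp add: divide_le_eq)
      qed
      have mn1: "1 \<le> mn m" using elim K1 by simp
      have mnmx: "mn m \<le> mx m"
        using n_min_n_max_bounds[OF K0, of "n m" "z m"] unfolding mn_def mx_def by linarith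
      have "(mx m)\<^sup>2 * (\<theta> m)\<^sup>2 * noise (mn m) (\<theta> m) \<le> (2 * c ^ 3) * ((mn m)\<^sup>2 * (\<theta> m - \<rho> m) ^ 3)"
      proof (rule noise_hypothesis[OF mn1 mnmx _ p(3) _ c(1)])
        show "1 \<le> ln (mn m)" "0 < \<theta> m - \<rho> m" using elim p by auto
      qed (unfold mn_def mx_def, rule hyp[rule_format])
      also have "\<dots> \<le> \<epsilon> * ((mn m)\<^sup>2 * (\<theta> m - \<rho> m) ^ 3)"
        using c3 p by (intro mult_right_mono) auto
      finally have signal: "(mx m)\<^sup>2 * (\<theta> m)\<^sup>2 * noise (mn m) (\<theta> m) \<le> \<epsilon> * ((mn m)\<^sup>2 * (\<theta> m - \<rho> m) ^ 3)" .
      have large': "1 \<le> ln (real (n_min K (n m) (z m)))" "(ln (real (n_min K (n m) (z m))))\<^sup>2 \<le> real (n_min K (n m) (z m))"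
        "real K \<le> real (n_min K (n m) (z m))"
        using elim by (auto simp: mn_def)
      have z': "z m ` {..<n m} = {..<K}" and C1: "1 \<le> C" using z assms(2) by auto
      show ?case unfolding Q_def t_def mn_def mx_def
        by (rule sbm_recovery_probability[OF K0 large'(3) z' p(1,2,4) C1 p(5) assms(4) large'(1,2) \<epsilon>0
              \<epsilon>(1)[unfolded x1_def] \<epsilon>3 \<epsilon>4 \<epsilon>(4)[unfolded x4_def] signal[unfolded mn_def mx_def]])
    qed
    moreover have "(\<lambda>m. 1 - 4 / (mn m)\<^sup>2) \<longlonglongrightarrow> 1"
    proof -
      have "((\<lambda>x::real. 1 - 4 / x\<^sup>2) \<longlongrightarrow> 1) at_top" by real_asymp
      then show ?thesis using mn by (rule filterlim_compose)
    qed
    ultimately have "Q \<longlonglongrightarrow> 1"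
      using always_eventually[of "\<lambda>m. Q m \<le> 1"] tendsto_sandwich[where f="\<lambda>m. 1 - 4 / (mn m)\<^sup>2" and g=Q and h="\<lambda>_. 1"]
      by (simp add: Q_def)
    then show "\<exists>t :: nat \<Rightarrow> real.
          (\<lambda>m. measure_pmf.prob (sbm (n m) (z m) (\<theta> m) (\<rho> m))
             {g. \<forall>i<n m. \<forall>j<n m.
                AWCD1 (n m) (adjacency g) (t m) i j = same_community (z m) i j}) \<longlonglongrightarrow> 1"
      unfolding Q_def by (rule exI[of _ t])
  qed
qed

end
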